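(* Let $X$ be a nonnegative random variable and $0<p<q<\infty$. The following conditions are equivalent: (i) there exists a constant $C>0$ such that $\|M_n(X)\|_q\le C\|M_n(X)\|_p$ for all $n\ge 1$; (ii) for each $\rho>0$ there exists a constant $B$ such that $E X^q I(X>t)\le B^q t^q P(X>t)$ for all $t\ge t_0=\rho\|X\|_p$; (iii) for each $\rho,\varepsilon>0$ there exists a constant $D>1$ such that $D^qP(X>Dt)\le\varepsilon P(X>t)$ for all $t\ge t_0=\rho\|X\|_p$; (iv) there exists a constant $\sigma>0$ such that $(E(t\vee\sigma X)^q)^{1/q}\le (E(t\vee X)^p)^{1/p}$ for all $t\ge 0$.
   Context: For a random variable $W$ and $r>0$, $\|W\|_r=(E|W|^r)^{1/r}\in[0,\infty]$. For a nonnegative random variable $X$ and $n\ge 1$, $M_n(X)=\max_{j\le n}X_j$, where $X_1,\dots,X_n$ are i.i.d. copies of $X$. $x\vee y=\max\{x,y\}$, and $I(\cdot)$ denotes an indicator. In (ii) and (iii), $t$ ranges over finite real numbers. *)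

theory Defs
  imports "HOL-Probability.Probability"
begin

text \<open>
  The quantities below live in \<open>[0,\<infinity>]\<close>, since none of the moments is assumed finite.
  The library has no real powers of extended nonnegative reals; this one is only used
  for positive exponents, hence \<open>\<infinity>\<close> is sent to \<open>\<infinity>\<close>.
\<close>

definition ennreal_powr :: "ennreal \<Rightarrow> real \<Rightarrow> ennreal" where
  "ennreal_powr x r = (if x = \<infinity> then \<infinity> else ennreal (enn2real x powr r))"

definition Lr_norm :: "'a measure \<Rightarrow> real \<Rightarrow> ('a \<Rightarrow> real) \<Rightarrow> ennreal" where
  "Lr_norm M r W = ennreal_powr (\<integral>\<^sup>+ \<omega>. ennreal (\<bar>W \<omega>\<bar> powr r) \<partial>M) (1 / r)"

definition iid_copies ::
    "'a measure \<Rightarrow> ('a \<Rightarrow> real) \<Rightarrow> 'b measure \<Rightarrow> (nat \<Rightarrow> 'b \<Rightarrow> real) \<Rightarrow> nat \<Rightarrow> bool" where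
  "iid_copies M X N Y n \<longleftrightarrow>
     prob_space N \<and>
     prob_space.indep_vars N (\<lambda>_. borel) Y {1..n} \<and>
     (\<forall>j\<in>{1..n}. distr N borel (Y j) = distr M borel X)"

definition max_upto :: "(nat \<Rightarrow> 'b \<Rightarrow> real) \<Rightarrow> nat \<Rightarrow> 'b \<Rightarrow> real" where
  "max_upto Y n = (\<lambda>\<omega>. Max ((\<lambda>j. Y j \<omega>) ` {1..n}))"

text \<open>
  Copies always exist: the coordinates of the \<open>n\<close>-fold product space realise them.
\<close>

lemma iid_copies_PiM:
  assumes "prob_space M" and "X \<in> borel_measurable M" and "n \<ge> 1"
  shows "iid_copies M X (PiM {1..n} (\<lambda>_. M)) (\<lambda>j \<omega>. X (\<omega> j)) n"
proof -
  interpret M: prob_space M by fact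
  interpret N: prob_space "PiM {1..n} (\<lambda>_. M)"
    by (intro prob_space_PiM M.prob_space_axioms)
  have meas: "(\<lambda>\<omega>. \<omega> j) \<in> PiM {1..n} (\<lambda>_. M) \<rightarrow>\<^sub>M M" if "j \<in> {1..n}" for j
    using that by simp
  have coord: "distr (PiM {1..n} (\<lambda>_. M)) M (\<lambda>\<omega>. \<omega> j) = M" if "j \<in> {1..n}" for j
    using that by (intro distr_PiM_component) (auto simp: M.prob_space_axioms)
  have "distr (PiM {1..n} (\<lambda>_. M)) (PiM {1..n} (\<lambda>_. M)) (\<lambda>\<omega>. \<lambda>j\<in>{1..n}. \<omega> j)
      = distr (PiM {1..n} (\<lambda>_. M)) (PiM {1..n} (\<lambda>_. M)) (\<lambda>\<omega>. \<omega>)"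
    by (intro distr_cong) (auto simp: space_PiM restrict_PiE_iff PiE_restrict)
  also have "\<dots> = PiM {1..n} (\<lambda>_. M)" by (rule distr_id2) simp
  also have "\<dots> = PiM {1..n} (\<lambda>j. distr (PiM {1..n} (\<lambda>_. M)) M (\<lambda>\<omega>. \<omega> j))"
    by (intro PiM_cong) (simp_all only: coord)
  finally have "N.indep_vars (\<lambda>_. M) (\<lambda>j \<omega>. \<omega> j) {1..n}"
    using assms(3) meas by (subst N.indep_vars_iff_distr_eq_PiM') auto
  then have indep: "N.indep_vars (\<lambda>_. borel) (\<lambda>j \<omega>. X (\<omega> j)) {1..n}"
    by (rule N.indep_vars_compose2) (rule assms(2))
  have "distr (PiM {1..n} (\<lambda>_. M)) borel (\<lambda>\<omega>. X (\<omega> j)) = distr M borel X"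
    if j: "j \<in> {1..n}" for j
  proof -
    have "distr (PiM {1..n} (\<lambda>_. M)) borel (\<lambda>\<omega>. X (\<omega> j))
        = distr (distr (PiM {1..n} (\<lambda>_. M)) M (\<lambda>\<omega>. \<omega> j)) borel X"
      using meas[OF j] assms(2) by (simp add: distr_distr comp_def)
    then show ?thesis by (simp only: coord[OF j])
  qed
  then show ?thesis
    using indep N.prob_space_axioms by (simp add: iid_copies_def)
qed

end

theory Submission
  imports Defs
begin

text \<open>
  Write \<open>m\<close> for the \<open>p\<close>-norm of \<open>X\<close>, \<open>G(t) = P(X > t)\<close> and
  \<open>\<phi>(t) = E X\<^sup>q I(X > t)\<close>. If \<open>m = \<infinity>\<close> or \<open>X = 0\<close> almost surely, all four conditions hold
  trivially. Otherwise every threshold \<open>\<rho> m\<close> is a positive real number, and (ii) serves as the hub: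
  it says that \<open>\<phi>(t)\<close> is comparable to its trivial lower bound \<open>t\<^sup>q G(t)\<close> on every range
  \<open>t \<ge> \<rho> m\<close>.

  (ii) and (iii): the bound in (ii) forces a fixed proportion of \<open>\<phi>(t)\<close> to come from
  \<open>t < X \<le> a t\<close> for a suitable \<open>a\<close>, so \<open>\<phi>\<close> decays geometrically along \<open>t, a t, a\<^sup>2 t, \<dots>\<close>, and
  with it \<open>t\<^sup>q G(t)\<close>. Conversely, if \<open>(D t)\<^sup>q G(D t) \<le> t\<^sup>q G(t) / 2\<close>, then cutting the event
  \<open>X > t\<close> into the layers \<open>D\<^sup>k t < X \<le> D\<^bsup>k+1\<^esup> t\<close> bounds \<open>\<phi>(t)\<close> by a geometric series.

  (ii) and (iv): raise (iv) to the power \<open>q\<close> and compare both sides with \<open>t\<^sup>q\<close>. The excess on the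
  left is at most \<open>E (\<sigma> X)\<^sup>q I(\<sigma> X > t)\<close>, and the excess on the right is at least a multiple of
  \<open>t\<^sup>q G(2 t)\<close>; (ii) and (iii) make the former smaller than the latter when \<open>\<sigma>\<close> is small, and small
  \<open>t\<close> are harmless since the right-hand side of (iv) is at least \<open>m\<close>. Conversely, (iv) bounds
  \<open>\<phi>(A t)\<close> by a multiple of \<open>t\<^bsup>q-p\<^esup> E X\<^sup>p I(X > t)\<close>; as \<open>t\<^bsup>q-p\<^esup> X\<^sup>p\<close> is a small multiple of \<open>X\<^sup>q\<close>
  where \<open>X > A t\<close>, that part can be absorbed on the left, and only \<open>t\<^sup>q G(t)\<close> remains.

  (ii) and (i): three estimates for the maximum \<open>Z\<close> of \<open>n\<close> copies carry the argument. The union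
  bound gives \<open>E Z\<^sup>q \<le> t\<^sup>q + n \<phi>(t)\<close>. The other two come from independence: if \<open>n G(t) \<ge> 1\<close> then
  \<open>P(Z > t) \<ge> 1/2\<close>, and if \<open>n G(t) \<le> 1/2\<close> then \<open>E Z\<^sup>q \<ge> n \<phi>(t) / 2\<close>, because a copy that exceeds \<open>t\<close>
  is then typically the only one. Given (ii), choose \<open>t\<close> with \<open>n G(t)\<close> about \<open>1\<close>, or \<open>t = m\<close> if that
  is larger: both norms of \<open>Z\<close> are then comparable to \<open>t\<close>. Given (i), choose \<open>n\<close> of the order
  \<open>\<delta> / G(t)\<close> with \<open>\<delta>\<close> small: comparable \<open>p\<close>- and \<open>q\<close>-norms prevent the \<open>p\<close>-th moment of \<open>Z\<close> from
  sitting on the unlikely event \<open>Z > t\<close>, hence it is at most \<open>2 t\<^sup>p\<close>, so \<open>n \<phi>(t)\<close> is at most a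
  multiple of \<open>t\<^sup>q\<close>, which is (ii).
\<close>

section \<open>Elementary inequalities for real powers\<close>

text \<open>
  By the mean value theorem, with the slope bounded by its value at \<open>1 + R\<close>. It turns the exponent
  \<open>q / p\<close> of a \<open>p\<close>-th moment into a linear bound as long as the excess over \<open>1\<close> stays bounded.
\<close>

lemma one_plus_powr_le_linear:
  fixes a R r :: real
  assumes "0 \<le> a" "a \<le> R" "1 \<le> r"
  shows "(1 + a) powr r \<le> 1 + r * (1 + R) powr (r - 1) * a"
proof (cases "a = 0")
  case False
  with assms have "1 < 1 + a" by simp
  moreover have "((\<lambda>x. x powr r) has_real_derivative r * x powr (r - 1)) (at x)" if "1 \<le> x" for x
    using that by (intro has_real_derivative_powr) simp
  ultimately obtain z where z: "1 < z" "z < 1 + a"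
    and eq: "(1 + a) powr r - 1 powr r = (1 + a - 1) * (r * z powr (r - 1))"
    using MVT2[of 1 "1 + a" "\<lambda>x. x powr r" "\<lambda>x. r * x powr (r - 1)"] by blast
  have "z powr (r - 1) \<le> (1 + R) powr (r - 1)"
    using z assms by (intro powr_mono2) auto
  then have "a * (r * z powr (r - 1)) \<le> a * (r * (1 + R) powr (r - 1))"
    using assms by (intro mult_left_mono) auto
  with eq show ?thesis by (simp add: algebra_simps)
qed simp

lemma ex_large_powr_neg_small:
  fixes a d L :: real
  assumes "0 < a" "0 < d"
  shows "\<exists>A\<ge>L. A powr (- a) < d"
proof -
  have "((\<lambda>A. A powr (- a)) \<longlongrightarrow> 0) at_top"
    using assms by (intro tendsto_neg_powr filterlim_ident) auto
  then have "eventually (\<lambda>A. A powr (- a) < d) at_top"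
    using assms by (auto dest: order_tendstoD)
  with eventually_ge_at_top[of L] have "eventually (\<lambda>A. A \<ge> L \<and> A powr (- a) < d) at_top"
    by eventually_elim auto
  then show ?thesis by (auto dest: eventually_happens simp: trivial_limit_at_top_linorder)
qed

text \<open>
  As \<open>x powr (p - q)\<close> decreases in \<open>x\<close>, a lower power is a small multiple of a higher one once \<open>x\<close> is
  large. This is how the contribution of large values to a \<open>p\<close>-th moment gets absorbed into a
  \<open>q\<close>-th moment.
\<close>

lemma powr_le_of_scaled_powr:
  fixes x s p q :: real
  assumes "0 < s" "s \<le> x" "p \<le> q"
  shows "x powr p \<le> s powr (p - q) * x powr q"
proof -
  have "x powr p = x powr (p - q) * x powr q"
    by (simp flip: powr_add)
  also have "\<dots> \<le> s powr (p - q) * x powr q"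
    using assms by (intro mult_right_mono powr_mono2') auto
  finally show ?thesis .
qed

lemma ennreal_le_suminf: "f k \<le> (\<Sum>k. f k)" for f :: "nat \<Rightarrow> ennreal"
  using sum_le_suminf[OF summableI, of "{k}" f] by simp

section \<open>Norms with values in the extended nonnegative reals\<close>

lemma Lr_norm_eq:
  assumes "integrable M (\<lambda>\<omega>. \<bar>W \<omega>\<bar> powr r)"
  shows "Lr_norm M r W = ennreal ((\<integral>\<omega>. \<bar>W \<omega>\<bar> powr r \<partial>M) powr (1 / r))"
  using assms by (simp add: Lr_norm_def ennreal_powr_def nn_integral_eq_integral)

lemma Lr_norm_infinite:
  "(\<integral>\<^sup>+ \<omega>. ennreal (\<bar>W \<omega>\<bar> powr r) \<partial>M) = \<infinity> \<Longrightarrow> Lr_norm M r W = \<infinity>"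
  by (simp add: Lr_norm_def ennreal_powr_def)

lemma Lr_norm_finite_imp_integrable:
  assumes [measurable]: "W \<in> borel_measurable M" and "Lr_norm M r W \<noteq> \<infinity>"
  shows "integrable M (\<lambda>\<omega>. \<bar>W \<omega>\<bar> powr r)"
proof (rule integrableI_nonneg)
  show "(\<integral>\<^sup>+\<omega>. ennreal (\<bar>W \<omega>\<bar> powr r) \<partial>M) < \<infinity>"
    using assms(2) Lr_norm_infinite[of M W r] by (metis infinity_ennreal_def top.not_eq_extremum)
qed auto

text \<open>
  A finite right-hand side forces the left-hand side to be finite; this is why integrability of
  the \<open>q\<close>-th power appears as a conclusion rather than as a hypothesis.
\<close>

lemma Lr_norm_le_iff:
  assumes [measurable]: "W \<in> borel_measurable M"
    and V: "integrable N (\<lambda>\<omega>. \<bar>V \<omega>\<bar> powr p)"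
    and pos: "0 < p" "0 < q" "0 \<le> C"
  shows "Lr_norm M q W \<le> ennreal C * Lr_norm N p V \<longleftrightarrow>
    integrable M (\<lambda>\<omega>. \<bar>W \<omega>\<bar> powr q) \<and>
    (\<integral>\<omega>. \<bar>W \<omega>\<bar> powr q \<partial>M) \<le> C powr q * (\<integral>\<omega>. \<bar>V \<omega>\<bar> powr p \<partial>N) powr (q / p)"
    (is "?L \<longleftrightarrow> ?I \<and> ?R")
proof -
  let ?w = "\<integral>\<omega>. \<bar>W \<omega>\<bar> powr q \<partial>M" and ?v = "\<integral>\<omega>. \<bar>V \<omega>\<bar> powr p \<partial>N"
  have rhs: "ennreal C * Lr_norm N p V = ennreal (C * ?v powr (1 / p))"
    using pos by (simp add: Lr_norm_eq[OF V] ennreal_mult)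
  have I: "?I" if ?L
    using that rhs by (intro Lr_norm_finite_imp_integrable) (auto simp: top_unique)
  have w0: "0 \<le> ?w" and v0: "0 \<le> ?v" by (auto intro!: integral_nonneg_AE)
  have "?L \<longleftrightarrow> ?R" if ?I
  proof -
    have "?L \<longleftrightarrow> ?w powr (1 / q) \<le> C * ?v powr (1 / p)"
      using pos by (simp add: rhs Lr_norm_eq[OF that] ennreal_le_iff)
    also have "\<dots> \<longleftrightarrow> (?w powr (1 / q)) powr q \<le> (C * ?v powr (1 / p)) powr q"
    proof
      assume "?w powr (1 / q) \<le> C * ?v powr (1 / p)"
      then show "(?w powr (1 / q)) powr q \<le> (C * ?v powr (1 / p)) powr q"
        using pos by (intro powr_mono2) auto
    next
      assume "(?w powr (1 / q)) powr q \<le> (C * ?v powr (1 / p)) powr q"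
      then show "?w powr (1 / q) \<le> C * ?v powr (1 / p)"
        using powr_less_mono2[of q "C * ?v powr (1 / p)" "?w powr (1 / q)"] pos
        by (meson linorder_not_less mult_nonneg_nonneg powr_ge_zero)
    qed
    also have "\<dots> \<longleftrightarrow> ?R"
      using pos w0 v0 by (simp add: powr_powr powr_mult)
    finally show ?thesis .
  qed
  with I show ?thesis by blast
qed

section \<open>Tails and truncated moments\<close>

text \<open>
  The nondegenerate case, in which the \<open>p\<close>-norm is a positive real number and all four conditions
  can be stated with real numbers.
\<close>

locale nonneg_rv = prob_space M for M :: "'a measure" +
  fixes X :: "'a \<Rightarrow> real" and p q :: real
  assumes rv [measurable]: "X \<in> borel_measurable M"
    and X_nonneg: "\<And>\<omega>. \<omega> \<in> space M \<Longrightarrow> 0 \<le> X \<omega>"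
    and p_pos: "0 < p" and p_less_q: "p < q"
    and int_p: "integrable M (\<lambda>\<omega>. X \<omega> powr p)"
    and moment_pos: "0 < expectation (\<lambda>\<omega>. X \<omega> powr p)"
begin

definition norm_p :: real where
  "norm_p = expectation (\<lambda>\<omega>. X \<omega> powr p) powr (1 / p)"

definition tail :: "real \<Rightarrow> real" where
  "tail t = prob {\<omega> \<in> space M. t < X \<omega>}"

definition tail_moment :: "real \<Rightarrow> real" where
  "tail_moment t = expectation (\<lambda>\<omega>. X \<omega> powr q * indicator {t<..} (X \<omega>))"

lemma q_pos: "0 < q"
  using p_pos p_less_q by simp

lemma norm_p_pos: "0 < norm_p"
  using moment_pos by (simp add: norm_p_def)

lemma norm_p_powr: "norm_p powr p = expectation (\<lambda>\<omega>. X \<omega> powr p)"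
  using moment_pos p_pos by (simp add: norm_p_def powr_powr)

lemma tail_eq: "tail t = expectation (\<lambda>\<omega>. indicator {t<..} (X \<omega>))"
proof -
  have "expectation (\<lambda>\<omega>. indicator {t<..} (X \<omega>) :: real)
      = expectation (indicator {\<omega> \<in> space M. t < X \<omega>})"
    by (intro Bochner_Integration.integral_cong) (auto simp: indicator_def)
  then show ?thesis by (simp add: tail_def)
qed

lemma tail_nonneg: "0 \<le> tail t"
  by (simp add: tail_def)

lemma int_indicator: "integrable M (\<lambda>\<omega>. indicator {t<..} (X \<omega>) :: real)"
  by (intro integrable_const_bound[where B = 1]) (auto simp: indicator_def)

lemma int_indicator_atMost: "integrable M (\<lambda>\<omega>. indicator {..t} (X \<omega>) :: real)"
  by (intro integrable_const_bound[where B = 1]) (auto simp: indicator_def)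

lemma expectation_indicator_atMost: "expectation (\<lambda>\<omega>. indicator {..t} (X \<omega>)) = 1 - tail t"
proof -
  have "(\<lambda>\<omega>. indicator {..t} (X \<omega>) :: real) = (\<lambda>\<omega>. 1 - indicator {t<..} (X \<omega>))"
    by (auto simp: indicator_def)
  then show ?thesis using int_indicator by (simp add: tail_eq prob_space)
qed

lemma tail_le_1: "tail t \<le> 1"
  by (simp add: tail_def)

lemma markov_p:
  assumes s: "0 < s"
  shows "tail s \<le> (norm_p / s) powr p"
proof -
  have "s powr p * tail s = expectation (\<lambda>\<omega>. s powr p * indicator {s<..} (X \<omega>))"
    by (simp add: tail_eq)
  also have "\<dots> \<le> expectation (\<lambda>\<omega>. X \<omega> powr p)"
    using s p_pos by (intro integral_mono int_p integrable_mult_right int_indicator)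
      (auto simp: indicator_def intro!: powr_mono2)
  finally show ?thesis
    using s norm_p_pos by (simp add: norm_p_powr powr_divide field_simps)
qed

lemma int_tail_moment:
  assumes "integrable M (\<lambda>\<omega>. X \<omega> powr q)"
  shows "integrable M (\<lambda>\<omega>. X \<omega> powr q * indicator {t<..} (X \<omega>))"
  by (rule Bochner_Integration.integrable_bound[OF assms]) (auto simp: indicator_def)

lemma tail_moment_nonneg: "0 \<le> tail_moment t"
  unfolding tail_moment_def by (intro integral_nonneg_AE) auto

lemma powr_tail_le_tail_moment:
  assumes "integrable M (\<lambda>\<omega>. X \<omega> powr q)" "0 \<le> t"
  shows "t powr q * tail t \<le> tail_moment t"
proof -
  have "t powr q * tail t = expectation (\<lambda>\<omega>. t powr q * indicator {t<..} (X \<omega>))"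
    by (simp add: tail_eq)
  also have "\<dots> \<le> tail_moment t"
    unfolding tail_moment_def using assms q_pos
    by (intro integral_mono int_tail_moment integrable_mult_right int_indicator)
      (auto simp: indicator_def intro!: powr_mono2)
  finally show ?thesis .
qed

text \<open>
  Real-valued forms of (ii), (iii) and (iv). In the first and the last, integrability of the \<open>q\<close>-th
  power has to be demanded separately, because the integral of a function that is not integrable is \<open>0\<close>, whereas the
  inequalities in \<open>[0,\<infinity>]\<close> entail it.
\<close>

definition tail_moment_bounded :: bool where
  "tail_moment_bounded \<longleftrightarrow> integrable M (\<lambda>\<omega>. X \<omega> powr q) \<and>
    (\<forall>\<rho>>0. \<exists>b\<ge>0. \<forall>t\<ge>\<rho> * norm_p. tail_moment t \<le> b * t powr q * tail t)"

definition tail_decays :: bool where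
  "tail_decays \<longleftrightarrow> (\<forall>\<rho>>0. \<forall>\<epsilon>>0. \<exists>D>1. \<forall>t\<ge>\<rho> * norm_p.
    D powr q * tail (D * t) \<le> \<epsilon> * tail t)"

definition max_contraction :: bool where
  "max_contraction \<longleftrightarrow> integrable M (\<lambda>\<omega>. X \<omega> powr q) \<and> (\<exists>\<sigma>>0. \<forall>t\<ge>0.
    expectation (\<lambda>\<omega>. max t (\<sigma> * X \<omega>) powr q)
      \<le> expectation (\<lambda>\<omega>. max t (X \<omega>) powr p) powr (q / p))"

text \<open>
  Splitting \<open>X > t\<close> at \<open>a t\<close> gives
  \<open>t\<^sup>q tail t \<le> a powr (- q) * tail_moment (a t) + (tail_moment t - tail_moment (a t))\<close>. If the tail moment at
  \<open>t\<close> is at most \<open>c\<close> times the left-hand side and \<open>a\<^sup>q = 2 c\<close>, this rearranges to a contraction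
  of the tail moment by a factor \<open>\<theta> < 1\<close> from \<open>t\<close> to \<open>a t\<close>; iterating it beats any \<open>\<epsilon>\<close>.
\<close>

lemma tail_moment_bounded_imp_tail_decays:
  assumes tail_moment_bounded
  shows tail_decays
  unfolding tail_decays_def
proof (intro allI impI)
  fix \<rho> \<epsilon> :: real assume \<rho>: "0 < \<rho>" and \<epsilon>: "0 < \<epsilon>"
  have int_q: "integrable M (\<lambda>\<omega>. X \<omega> powr q)"
    using assms by (simp add: tail_moment_bounded_def)
  obtain b where b: "b \<ge> 0" and bound: "\<And>t. t \<ge> \<rho> * norm_p \<Longrightarrow> tail_moment t \<le> b * t powr q * tail t"
    using assms \<rho> unfolding tail_moment_bounded_def by blast
  \<comment> \<open>\<open>c \<ge> 1\<close> keeps \<open>\<theta>\<close> nonnegative and \<open>a > 1\<close>.\<close>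
  define c where "c = b + 1"
  define a where "a = (2 * c) powr (1 / q)"
  define \<theta> where "\<theta> = (c - 1) / (c - 1 / 2)"
  have c: "1 \<le> c" using b by (simp add: c_def)
  have aq: "a powr q = 2 * c" using c q_pos by (simp add: a_def powr_powr)
  have a: "1 < a" using c q_pos by (simp add: a_def)
  have \<theta>: "0 \<le> \<theta>" "\<theta> < 1" using c by (auto simp: \<theta>_def)
  have t0: "0 < \<rho> * norm_p" using \<rho> norm_p_pos by simp
  have step: "tail_moment (a * t) \<le> \<theta> * tail_moment t" if t: "t \<ge> \<rho> * norm_p" for t
  proof -
    have tpos: "0 < t" using t t0 by simp
    have "t powr q * tail t = expectation (\<lambda>\<omega>. t powr q * indicator {t<..} (X \<omega>))"
      by (simp add: tail_eq)
    also have "\<dots> \<le> expectation (\<lambda>\<omega>. (X \<omega> powr q * indicator {a * t<..} (X \<omega>)) / (2 * c)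
        + X \<omega> powr q * indicator {t<..} (X \<omega>) - X \<omega> powr q * indicator {a * t<..} (X \<omega>))"
    proof (intro integral_mono integrable_mult_right int_indicator
        Bochner_Integration.integrable_diff Bochner_Integration.integrable_add
        Bochner_Integration.integrable_divide int_tail_moment int_q)
      fix \<omega> assume "\<omega> \<in> space M"
      have at: "t < a * t" using a tpos by simp
      have "t powr q \<le> X \<omega> powr q" if "t < X \<omega>"
        using that tpos q_pos by (intro powr_mono2) auto
      moreover have "t powr q \<le> X \<omega> powr q / (2 * c)" if "a * t < X \<omega>"
      proof -
        have "(a * t) powr q \<le> X \<omega> powr q"
          using that tpos a q_pos by (intro powr_mono2) auto
        then show ?thesis using c a tpos aq by (simp add: powr_mult field_simps)
      qed
      ultimately show "t powr q * indicator {t<..} (X \<omega>)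
        \<le> (X \<omega> powr q * indicator {a * t<..} (X \<omega>)) / (2 * c)
        + X \<omega> powr q * indicator {t<..} (X \<omega>) - X \<omega> powr q * indicator {a * t<..} (X \<omega>)"
        using at by (auto simp: indicator_def)
    qed
    also have "\<dots> = tail_moment (a * t) / (2 * c) + tail_moment t - tail_moment (a * t)"
      by (simp add: tail_moment_def int_tail_moment[OF int_q])
    finally have *: "t powr q * tail t \<le> tail_moment (a * t) / (2 * c) + tail_moment t - tail_moment (a * t)" .
    have "tail_moment t \<le> b * t powr q * tail t" using bound t by blast
    also have "\<dots> \<le> c * (t powr q * tail t)"
      using tail_nonneg[of t] by (simp add: c_def algebra_simps)
    also have "\<dots> \<le> c * (tail_moment (a * t) / (2 * c) + tail_moment t - tail_moment (a * t))"
      using * c by (intro mult_left_mono) auto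
    also have "\<dots> = tail_moment (a * t) / 2 + c * tail_moment t - c * tail_moment (a * t)"
      using c by (simp add: algebra_simps)
    finally have "(c - 1 / 2) * tail_moment (a * t) \<le> (c - 1) * tail_moment t"
      by (simp add: algebra_simps)
    then show ?thesis using c by (simp add: \<theta>_def field_simps)
  qed
  have iter: "tail_moment (a ^ k * t) \<le> \<theta> ^ k * tail_moment t" if t: "t \<ge> \<rho> * norm_p" for t k
  proof (induction k)
    case (Suc k)
    have "1 * t \<le> a ^ k * t" using a t t0 by (intro mult_right_mono) auto
    then have "tail_moment (a * (a ^ k * t)) \<le> \<theta> * tail_moment (a ^ k * t)"
      using t by (intro step) auto
    also have "\<dots> \<le> \<theta> * (\<theta> ^ k * tail_moment t)"
      using Suc \<theta> by (intro mult_left_mono) auto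
    finally show ?case by (simp add: mult.assoc)
  qed simp
  obtain k0 where k0: "\<theta> ^ k0 < \<epsilon> / c" using \<theta> \<epsilon> c
    by (metis real_arch_pow_inv divide_pos_pos less_le_trans zero_less_one)
  \<comment> \<open>A positive exponent, so that \<open>a ^ k > 1\<close>.\<close>
  define k where "k = Suc k0"
  have k: "\<theta> ^ k * b \<le> \<epsilon>"
  proof -
    have "\<theta> ^ k \<le> \<theta> ^ k0" using \<theta> by (simp add: k_def mult_left_le_one_le)
    then have "\<theta> ^ k * b \<le> (\<epsilon> / c) * c"
      using k0 \<theta> b c \<epsilon> by (intro mult_mono) (auto simp: c_def)
    then show ?thesis using c by simp
  qed
  have "1 < a ^ k" using a unfolding k_def by (intro one_less_power) auto
  moreover have "(a ^ k) powr q * tail (a ^ k * t) \<le> \<epsilon> * tail t" if t: "t \<ge> \<rho> * norm_p" for t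
  proof -
    have tpos: "0 < t" using t t0 by simp
    have "t powr q * ((a ^ k) powr q * tail (a ^ k * t)) = (a ^ k * t) powr q * tail (a ^ k * t)"
      using a tpos by (simp add: powr_mult)
    also have "\<dots> \<le> tail_moment (a ^ k * t)"
      using a tpos by (intro powr_tail_le_tail_moment int_q) auto
    also have "\<dots> \<le> \<theta> ^ k * tail_moment t" using iter t by blast
    also have "\<dots> \<le> \<theta> ^ k * (b * t powr q * tail t)"
      using bound[OF t] \<theta> by (intro mult_left_mono) auto
    also have "\<dots> = (\<theta> ^ k * b) * (t powr q * tail t)" by simp
    also have "\<dots> \<le> \<epsilon> * (t powr q * tail t)"
      using k tail_nonneg by (intro mult_right_mono) auto
    finally have "t powr q * ((a ^ k) powr q * tail (a ^ k * t)) \<le> t powr q * (\<epsilon> * tail t)"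
      by (simp add: mult_ac)
    then show ?thesis using tpos by simp
  qed
  ultimately show "\<exists>D>1. \<forall>t\<ge>\<rho> * norm_p. D powr q * tail (D * t) \<le> \<epsilon> * tail t"
    by blast
qed

text \<open>
  A single finite tail moment makes the whole \<open>q\<close>-th moment finite, because
  \<open>X\<^sup>q \<le> t\<^sup>q + X\<^sup>q I(X > t)\<close>.
\<close>

lemma nn_tail_moment_le_imp:
  assumes "(\<integral>\<^sup>+\<omega>. ennreal (X \<omega> powr q * indicator {t<..} (X \<omega>)) \<partial>M) \<le> ennreal c"
    and "0 \<le> t" "0 \<le> c"
  shows "integrable M (\<lambda>\<omega>. X \<omega> powr q)" "tail_moment t \<le> c"
proof -
  have fin: "(\<integral>\<^sup>+\<omega>. ennreal (X \<omega> powr q * indicator {t<..} (X \<omega>)) \<partial>M) < \<infinity>"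
    unfolding infinity_ennreal_def using assms(1) ennreal_less_top by (rule le_less_trans)
  have int: "integrable M (\<lambda>\<omega>. X \<omega> powr q * indicator {t<..} (X \<omega>))"
    using fin by (intro integrableI_nonneg) auto
  then have "integrable M (\<lambda>\<omega>. t powr q + X \<omega> powr q * indicator {t<..} (X \<omega>))"
    by simp
  then show "integrable M (\<lambda>\<omega>. X \<omega> powr q)"
  proof (rule Bochner_Integration.integrable_bound)
    show "AE \<omega> in M. norm (X \<omega> powr q) \<le> norm (t powr q + X \<omega> powr q * indicator {t<..} (X \<omega>))"
      using X_nonneg q_pos assms(2) by (intro AE_I2) (auto simp: indicator_def intro!: powr_mono2)
  qed simp
  show "tail_moment t \<le> c"
    using assms(1,3) int unfolding tail_moment_def
    by (subst (asm) nn_integral_eq_integral) auto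
qed

text \<open>
  Take \<open>\<epsilon> = 1/2\<close>. On the layer \<open>D\<^sup>k t < X \<le> D\<^bsup>k+1\<^esup> t\<close> the integrand is at most
  \<open>(D\<^bsup>k+1\<^esup> t)\<^sup>q\<close>, and the decay of the tail makes the layers contribute a geometric series. The
  argument runs in \<open>[0,\<infinity>]\<close>, since integrability of the \<open>q\<close>-th power is part of what is to be shown.
\<close>

lemma tail_decays_imp_tail_moment_bounded:
  assumes tail_decays
  shows tail_moment_bounded
proof -
  have main: "\<exists>b\<ge>0. \<forall>t\<ge>\<rho> * norm_p.
      (\<integral>\<^sup>+\<omega>. ennreal (X \<omega> powr q * indicator {t<..} (X \<omega>)) \<partial>M) \<le> ennreal (b * t powr q * tail t)"
    if \<rho>: "0 < \<rho>" for \<rho>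
  proof -
    have t0: "0 < \<rho> * norm_p" using \<rho> norm_p_pos by simp
    obtain D where D: "1 < D"
      and decay: "\<And>t. t \<ge> \<rho> * norm_p \<Longrightarrow> D powr q * tail (D * t) \<le> 1 / 2 * tail t"
      using assms \<rho> unfolding tail_decays_def by (metis zero_less_divide_1_iff zero_less_numeral)
    have "(\<integral>\<^sup>+\<omega>. ennreal (X \<omega> powr q * indicator {t<..} (X \<omega>)) \<partial>M)
        \<le> ennreal (2 * D powr q * t powr q * tail t)" if t: "t \<ge> \<rho> * norm_p" for t
    proof -
      have tpos: "0 < t" using t t0 by simp
      have ge: "t \<le> D ^ k * t" for k using D tpos by simp
      have layer: "(D ^ k * t) powr q * tail (D ^ k * t) \<le> (1 / 2) ^ k * (t powr q * tail t)" for k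
      proof (induction k)
        case (Suc k)
        have "(D ^ Suc k * t) powr q * tail (D ^ Suc k * t)
            = (D ^ k * t) powr q * (D powr q * tail (D * (D ^ k * t)))"
          using D tpos by (simp add: powr_mult mult_ac)
        also have "\<dots> \<le> (D ^ k * t) powr q * (1 / 2 * tail (D ^ k * t))"
          using ge[of k] t by (intro mult_left_mono decay) auto
        also have "\<dots> \<le> 1 / 2 * ((1 / 2) ^ k * (t powr q * tail t))"
          using Suc by simp
        finally show ?case by simp
      qed simp
      have "(\<integral>\<^sup>+\<omega>. ennreal (X \<omega> powr q * indicator {t<..} (X \<omega>)) \<partial>M)
          \<le> (\<integral>\<^sup>+\<omega>. (\<Sum>k. ennreal ((D ^ Suc k * t) powr q * indicator {D ^ k * t<..} (X \<omega>))) \<partial>M)"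
      proof (rule nn_integral_mono)
        fix \<omega> assume "\<omega> \<in> space M"
        show "ennreal (X \<omega> powr q * indicator {t<..} (X \<omega>))
          \<le> (\<Sum>k. ennreal ((D ^ Suc k * t) powr q * indicator {D ^ k * t<..} (X \<omega>)))"
        proof (cases "t < X \<omega>")
          case True
          \<comment> \<open>The layer containing the value of \<open>X\<close>.\<close>
          define k where "k = (LEAST k. X \<omega> \<le> D ^ Suc k * t)"
          have "\<exists>k. X \<omega> \<le> D ^ Suc k * t"
          proof -
            obtain k where "X \<omega> / t < D ^ k" using real_arch_pow[OF D] by blast
            then have "X \<omega> < D ^ k * t" using tpos by (simp add: field_simps)
            also have "\<dots> \<le> D ^ Suc k * t" using D tpos by simp
            finally show ?thesis by (intro exI[of _ k]) auto
          qed
          then have up: "X \<omega> \<le> D ^ Suc k * t" unfolding k_def by (rule LeastI_ex)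
          have low: "D ^ k * t < X \<omega>"
          proof (cases k)
            case (Suc j)
            then have "j < (LEAST k. X \<omega> \<le> D ^ Suc k * t)" unfolding k_def by simp
            then have "\<not> X \<omega> \<le> D ^ Suc j * t" by (rule not_less_Least)
            then show ?thesis using Suc by simp
          qed (use True in simp)
          have "ennreal (X \<omega> powr q * indicator {t<..} (X \<omega>))
              \<le> ennreal ((D ^ Suc k * t) powr q * indicator {D ^ k * t<..} (X \<omega>))"
            using True low powr_mono2[OF less_imp_le[OF q_pos] _ up] tpos
            by (simp add: ennreal_leI del: power_Suc)
          also have "\<dots> \<le> (\<Sum>k. ennreal ((D ^ Suc k * t) powr q * indicator {D ^ k * t<..} (X \<omega>)))"
            by (rule ennreal_le_suminf)
          finally show ?thesis .
        qed simp
      qed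
      also have "\<dots> = (\<Sum>k. \<integral>\<^sup>+\<omega>. ennreal ((D ^ Suc k * t) powr q * indicator {D ^ k * t<..} (X \<omega>)) \<partial>M)"
        by (intro nn_integral_suminf) measurable
      also have "\<dots> \<le> (\<Sum>k. ennreal (D powr q * (t powr q * tail t) * (1 / 2) ^ k))"
      proof (intro suminf_le)
        fix k
        have "(\<integral>\<^sup>+\<omega>. ennreal ((D ^ Suc k * t) powr q * indicator {D ^ k * t<..} (X \<omega>)) \<partial>M)
            = ennreal ((D ^ Suc k * t) powr q * tail (D ^ k * t))"
          by (subst nn_integral_eq_integral) (auto simp: tail_eq int_indicator simp del: power_Suc)
        also have "(D ^ Suc k * t) powr q * tail (D ^ k * t)
            = D powr q * ((D ^ k * t) powr q * tail (D ^ k * t))"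
          using D tpos by (simp add: powr_mult mult_ac)
        also have "ennreal \<dots> \<le> ennreal (D powr q * ((1 / 2) ^ k * (t powr q * tail t)))"
          by (intro ennreal_leI mult_left_mono layer) auto
        finally show "(\<integral>\<^sup>+\<omega>. ennreal ((D ^ Suc k * t) powr q * indicator {D ^ k * t<..} (X \<omega>)) \<partial>M)
            \<le> ennreal (D powr q * (t powr q * tail t) * (1 / 2) ^ k)"
          by (simp add: mult_ac)
      qed auto
      also have "\<dots> = ennreal (D powr q * (t powr q * tail t) * 2)"
      proof (rule suminf_ennreal_eq)
        have "(\<lambda>k. (1 / 2 :: real) ^ k) sums 2"
          using geometric_sums[of "1 / 2 :: real"] by simp
        then show "(\<lambda>k. D powr q * (t powr q * tail t) * (1 / 2) ^ k) sums (D powr q * (t powr q * tail t) * 2)"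
          by (rule sums_mult)
      qed (use tail_nonneg in auto)
      finally show ?thesis by (simp add: mult_ac)
    qed
    then show ?thesis by (intro exI[of _ "2 * D powr q"]) auto
  qed
  show ?thesis
    unfolding tail_moment_bounded_def
  proof (intro conjI allI impI)
    obtain b where "b \<ge> 0" "\<forall>t\<ge>1 * norm_p.
      (\<integral>\<^sup>+\<omega>. ennreal (X \<omega> powr q * indicator {t<..} (X \<omega>)) \<partial>M) \<le> ennreal (b * t powr q * tail t)"
      using main[of 1] by auto
    then show "integrable M (\<lambda>\<omega>. X \<omega> powr q)"
      using norm_p_pos tail_nonneg by (intro nn_tail_moment_le_imp(1)[of norm_p "b * norm_p powr q * tail norm_p"]) auto
  next
    fix \<rho> :: real assume \<rho>: "0 < \<rho>"
    then have t0: "0 < \<rho> * norm_p" using norm_p_pos by simp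
    obtain b where "b \<ge> 0" "\<forall>t\<ge>\<rho> * norm_p.
      (\<integral>\<^sup>+\<omega>. ennreal (X \<omega> powr q * indicator {t<..} (X \<omega>)) \<partial>M) \<le> ennreal (b * t powr q * tail t)"
      using main[OF \<rho>] by auto
    then show "\<exists>b\<ge>0. \<forall>t\<ge>\<rho> * norm_p. tail_moment t \<le> b * t powr q * tail t"
      using t0 tail_nonneg by (intro exI[of _ b]) (auto intro!: nn_tail_moment_le_imp(2))
  qed
qed


lemma int_max_powr:
  assumes "integrable M (\<lambda>\<omega>. X \<omega> powr r)" "0 < r" "0 \<le> t" "0 \<le> \<sigma>"
  shows "integrable M (\<lambda>\<omega>. max t (\<sigma> * X \<omega>) powr r)"
proof (rule Bochner_Integration.integrable_bound)
  show "integrable M (\<lambda>\<omega>. t powr r + \<sigma> powr r * X \<omega> powr r)"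
    using assms by simp
  show "AE \<omega> in M. norm (max t (\<sigma> * X \<omega>) powr r) \<le> norm (t powr r + \<sigma> powr r * X \<omega> powr r)"
    using X_nonneg assms by (intro AE_I2) (auto simp: max_def powr_mult)
qed simp

text \<open>
  For \<open>t \<ge> norm_p / 2\<close>, the left-hand side is at most \<open>t\<^sup>q + \<sigma>\<^sup>q tail_moment (2 D t)\<close> when
  \<open>2 D \<sigma> \<le> 1\<close>. The bound on the tail moment and the decay from \<open>2 t\<close> to \<open>2 D t\<close> turn this into
  \<open>t\<^sup>q (1 + b \<epsilon> tail (2 t))\<close>. On the right, \<open>X > 2 t\<close> alone
  contributes an excess \<open>(2\<^sup>p - 1) t\<^sup>p tail (2 t)\<close>, and raising to the power \<open>q / p \<ge> 1\<close> only
  enlarges it; so \<open>b \<epsilon> \<le> 2\<^sup>p - 1\<close> suffices. For smaller \<open>t\<close> the right-hand side is at least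
  \<open>norm_p powr q\<close>, which leaves room for \<open>\<sigma>\<^sup>q E X\<^sup>q\<close> if \<open>\<sigma>\<close> is small.
\<close>

lemma tail_moment_bounded_imp_max_contraction:
  assumes tail_moment_bounded
  shows max_contraction
  unfolding max_contraction_def
proof (intro conjI)
  show int_q: "integrable M (\<lambda>\<omega>. X \<omega> powr q)"
    using assms by (simp add: tail_moment_bounded_def)
  obtain b where b: "b \<ge> 0"
    and bound: "\<And>t. t \<ge> 1 / 2 * norm_p \<Longrightarrow> tail_moment t \<le> b * t powr q * tail t"
    using assms unfolding tail_moment_bounded_def
    by (metis zero_less_divide_1_iff zero_less_numeral)
  define \<epsilon> where "\<epsilon> = (2 powr p - 1) / (b + 1)"
  have twop: "1 < (2::real) powr p" using p_pos by simp
  then have \<epsilon>: "0 < \<epsilon>" "b * \<epsilon> \<le> 2 powr p - 1"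
    using b by (auto simp: \<epsilon>_def field_simps)
  obtain D where D: "1 < D"
    and decay: "\<And>t. t \<ge> 1 / 2 * norm_p \<Longrightarrow> D powr q * tail (D * t) \<le> \<epsilon> * tail t"
    using tail_moment_bounded_imp_tail_decays[OF assms] \<epsilon>(1) unfolding tail_decays_def
    by (metis zero_less_divide_1_iff zero_less_numeral)
  define J where "J = expectation (\<lambda>\<omega>. X \<omega> powr q)"
  have J: "0 \<le> J" unfolding J_def by (intro integral_nonneg_AE) auto
  have half: "(1 / 2 :: real) powr q < 1" using q_pos powr_less_mono2[of q "1 / 2" 1] by simp
  \<comment> \<open>The largest admissible value of \<open>\<sigma>\<^sup>q\<close> for \<open>t \<le> norm_p / 2\<close>, up to the \<open>+ 1\<close> that avoids division by zero.\<close>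
  define d where "d = norm_p powr q * (1 - (1 / 2) powr q) / (J + 1)"
  have d: "0 < d" "d * J \<le> norm_p powr q * (1 - (1 / 2) powr q)"
    using J half norm_p_pos by (auto simp: d_def field_simps)
  define \<sigma> where "\<sigma> = min (1 / (2 * D)) (d powr (1 / q))"
  have \<sigma>: "0 < \<sigma>" using D d by (simp add: \<sigma>_def)
  have \<sigma>q: "\<sigma> powr q \<le> d"
  proof -
    have "\<sigma> powr q \<le> (d powr (1 / q)) powr q"
      using \<sigma> q_pos by (intro powr_mono2) (auto simp: \<sigma>_def)
    then show ?thesis using d q_pos by (simp add: powr_powr)
  qed
  have \<sigma>D: "\<sigma> * (2 * D) \<le> 1"
  proof -
    have "\<sigma> * (2 * D) \<le> 1 / (2 * D) * (2 * D)"
      using D by (intro mult_right_mono) (auto simp: \<sigma>_def)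
    then show ?thesis using D by simp
  qed
  have int_maxp: "integrable M (\<lambda>\<omega>. max t (X \<omega>) powr p)" if "0 \<le> t" for t
    using int_max_powr[OF int_p p_pos that, of 1] by simp
  have "expectation (\<lambda>\<omega>. max t (\<sigma> * X \<omega>) powr q) \<le> expectation (\<lambda>\<omega>. max t (X \<omega>) powr p) powr (q / p)"
    if t: "0 \<le> t" for t
  proof (cases "t \<le> 1 / 2 * norm_p")
    case True
    have "expectation (\<lambda>\<omega>. max t (\<sigma> * X \<omega>) powr q)
        \<le> expectation (\<lambda>\<omega>. t powr q + \<sigma> powr q * X \<omega> powr q)"
      using t \<sigma> X_nonneg q_pos
      by (intro integral_mono int_max_powr int_q Bochner_Integration.integrable_add integrable_mult_right)
        (auto simp: max_def powr_mult)
    also have "\<dots> = t powr q + \<sigma> powr q * J"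
      using int_q by (simp add: J_def prob_space)
    also have "\<dots> \<le> (1 / 2 * norm_p) powr q + d * J"
      using True t q_pos \<sigma>q J by (intro add_mono powr_mono2 mult_right_mono) auto
    also have "\<dots> \<le> norm_p powr q"
      using d(2) norm_p_pos by (simp only: powr_mult) (simp add: algebra_simps)
    also have "\<dots> = expectation (\<lambda>\<omega>. X \<omega> powr p) powr (q / p)"
      using p_pos moment_pos by (simp add: norm_p_def powr_powr)
    also have "\<dots> \<le> expectation (\<lambda>\<omega>. max t (X \<omega>) powr p) powr (q / p)"
      using moment_pos p_pos q_pos X_nonneg t
      by (intro powr_mono2 integral_mono int_p int_maxp) auto
    finally show ?thesis .
  next
    case False
    then have tm: "t \<ge> 1 / 2 * norm_p" and tpos: "0 < t" using norm_p_pos by auto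
    have "t \<le> (2 * D) * t" using D tpos by simp
    then have tm': "2 * D * t \<ge> 1 / 2 * norm_p" using tm by linarith
    have "0 \<le> (2 powr p - 1) * tail (2 * t)"
      using twop tail_nonneg by (intro mult_nonneg_nonneg) auto
    then have ge1: "1 \<le> 1 + (2 powr p - 1) * tail (2 * t)" by simp
    have "expectation (\<lambda>\<omega>. max t (\<sigma> * X \<omega>) powr q)
        \<le> expectation (\<lambda>\<omega>. t powr q + \<sigma> powr q * (X \<omega> powr q * indicator {2 * D * t<..} (X \<omega>)))"
    proof (intro integral_mono int_max_powr int_q q_pos t Bochner_Integration.integrable_add
        integrable_mult_right int_tail_moment)
      fix \<omega> assume \<omega>: "\<omega> \<in> space M"
      show "max t (\<sigma> * X \<omega>) powr q \<le> t powr q + \<sigma> powr q * (X \<omega> powr q * indicator {2 * D * t<..} (X \<omega>))"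
      proof (cases "2 * D * t < X \<omega>")
        case True
        then show ?thesis using \<sigma> X_nonneg[OF \<omega>] by (auto simp: max_def powr_mult)
      next
        case False
        then have "\<sigma> * X \<omega> \<le> \<sigma> * (2 * D * t)" using \<sigma> by (intro mult_left_mono) auto
        also have "\<dots> = (\<sigma> * (2 * D)) * t" by simp
        also have "\<dots> \<le> 1 * t" using \<sigma>D t by (intro mult_right_mono) auto
        finally show ?thesis using False by (simp add: max_def)
      qed
    qed (use \<sigma> in auto)
    also have "\<dots> = t powr q + \<sigma> powr q * tail_moment (2 * D * t)"
      using int_tail_moment[OF int_q] by (simp add: tail_moment_def prob_space)
    also have "\<dots> \<le> t powr q + \<sigma> powr q * (b * (2 * D * t) powr q * tail (2 * D * t))"
      using bound[OF tm'] by (intro add_left_mono mult_left_mono) auto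
    also have "\<dots> = t powr q + (\<sigma> * (2 * D)) powr q * (t powr q * (b * tail (2 * D * t)))"
      using D t \<sigma> by (simp add: powr_mult mult_ac)
    also have "\<dots> \<le> t powr q + 1 * (t powr q * (b * tail (2 * D * t)))"
      using \<sigma>D \<sigma> D q_pos b tail_nonneg
      by (intro add_left_mono mult_right_mono powr_le1) auto
    also have "\<dots> \<le> t powr q + 1 * (t powr q * (b * (\<epsilon> * tail (2 * t))))"
    proof -
      have "1 * tail (D * (2 * t)) \<le> D powr q * tail (D * (2 * t))"
        using D q_pos tail_nonneg by (intro mult_right_mono ge_one_powr_ge_zero) auto
      also have "\<dots> \<le> \<epsilon> * tail (2 * t)" using tm tpos by (intro decay) auto
      finally have "tail (2 * D * t) \<le> \<epsilon> * tail (2 * t)" by (simp add: mult_ac)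
      then show ?thesis using b by (intro add_left_mono mult_left_mono) auto
    qed
    also have "\<dots> = t powr q * (1 + (b * \<epsilon>) * tail (2 * t))" by (simp add: algebra_simps)
    also have "\<dots> \<le> t powr q * (1 + (2 powr p - 1) * tail (2 * t))"
      using \<epsilon> tail_nonneg by (intro mult_left_mono add_left_mono mult_right_mono) auto
    also have "\<dots> \<le> t powr q * (1 + (2 powr p - 1) * tail (2 * t)) powr (q / p)"
    proof (intro mult_left_mono)
      have "1 + (2 powr p - 1) * tail (2 * t) = (1 + (2 powr p - 1) * tail (2 * t)) powr 1"
        using ge1 by (subst powr_one) auto
      also have "\<dots> \<le> (1 + (2 powr p - 1) * tail (2 * t)) powr (q / p)"
        using ge1 p_pos p_less_q by (intro powr_mono) auto
      finally show "1 + (2 powr p - 1) * tail (2 * t) \<le> \<dots>" .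
    qed simp
    also have "\<dots> = (t powr p * (1 + (2 powr p - 1) * tail (2 * t))) powr (q / p)"
      using p_pos twop tail_nonneg[of "2 * t"] by (simp add: powr_mult powr_powr)
    also have "\<dots> \<le> expectation (\<lambda>\<omega>. max t (X \<omega>) powr p) powr (q / p)"
    proof (intro powr_mono2)
      have "t powr p * (1 + (2 powr p - 1) * tail (2 * t))
          = expectation (\<lambda>\<omega>. t powr p + (t powr p * (2 powr p - 1)) * indicator {2 * t<..} (X \<omega>))"
        using int_indicator by (simp add: tail_eq prob_space algebra_simps)
      also have "\<dots> \<le> expectation (\<lambda>\<omega>. max t (X \<omega>) powr p)"
      proof (intro integral_mono int_maxp t Bochner_Integration.integrable_add
          integrable_mult_right int_indicator)
        fix \<omega>
        have "2 powr p * t powr p \<le> X \<omega> powr p" if "2 * t < X \<omega>"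
          using that tpos p_pos powr_mono2[of p "2 * t" "X \<omega>"] by (simp add: powr_mult)
        moreover have "t powr p \<le> max t (X \<omega>) powr p"
          using tpos p_pos by (intro powr_mono2) auto
        ultimately show "t powr p + (t powr p * (2 powr p - 1)) * indicator {2 * t<..} (X \<omega>)
            \<le> max t (X \<omega>) powr p"
          using tpos by (auto simp: indicator_def algebra_simps max_def)
      qed auto
      finally show "t powr p * (1 + (2 powr p - 1) * tail (2 * t)) \<le> \<dots>" .
      show "0 \<le> t powr p * (1 + (2 powr p - 1) * tail (2 * t))"
        using ge1 by (intro mult_nonneg_nonneg) auto
    qed (use p_pos q_pos in simp)
    finally show ?thesis .
  qed
  with \<sigma> show "\<exists>\<sigma>>0. \<forall>t\<ge>0. expectation (\<lambda>\<omega>. max t (\<sigma> * X \<omega>) powr q)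
      \<le> expectation (\<lambda>\<omega>. max t (X \<omega>) powr p) powr (q / p)"
    by blast
qed

text \<open>
  Let \<open>e\<close> be the excess of \<open>E max(t,X)\<^sup>p\<close> over \<open>t\<^sup>p\<close>. For \<open>t \<ge> \<rho> norm_p\<close> the ratio \<open>e / t\<^sup>p\<close> is at
  most \<open>R = \<rho> powr (- p)\<close>, so the contraction yields
  \<open>\<sigma>\<^sup>q tail_moment (A t) / 2 \<le> K t\<^bsup>q-p\<^esup> e\<close> with \<open>K\<close> depending on \<open>R\<close> only, provided
  \<open>(\<sigma> A)\<^sup>q \<ge> 2\<close>. The part of \<open>e\<close> coming from \<open>X > A t\<close> costs at most \<open>K A\<^bsup>p-q\<^esup> tail_moment (A t)\<close>,
  which for large \<open>A\<close> is absorbed on the left; the part from \<open>t < X \<le> A t\<close> costs a multiple of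
  \<open>t\<^sup>q tail t\<close>.
\<close>

lemma max_contraction_imp_tail_moment_bounded:
  assumes max_contraction
  shows tail_moment_bounded
  unfolding tail_moment_bounded_def
proof (intro conjI allI impI)
  show int_q: "integrable M (\<lambda>\<omega>. X \<omega> powr q)"
    using assms by (simp add: max_contraction_def)
  obtain \<sigma> where \<sigma>: "0 < \<sigma>" and contr: "\<And>t. 0 \<le> t \<Longrightarrow> expectation (\<lambda>\<omega>. max t (\<sigma> * X \<omega>) powr q)
      \<le> expectation (\<lambda>\<omega>. max t (X \<omega>) powr p) powr (q / p)"
    using assms unfolding max_contraction_def by blast
  fix \<rho> :: real assume \<rho>: "0 < \<rho>"
  have t0: "0 < \<rho> * norm_p" using \<rho> norm_p_pos by simp
  define R where "R = \<rho> powr (- p)"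
  define K where "K = q / p * (1 + R) powr (q / p - 1)"
  have R: "0 \<le> R" by (simp add: R_def)
  have K: "0 < K" using p_pos q_pos R by (simp add: K_def add_pos_nonneg)
  obtain A where A: "max 1 (2 powr (1 / q) / \<sigma>) \<le> A" and small: "A powr (- (q - p)) < \<sigma> powr q / (4 * K)"
    using ex_large_powr_neg_small[of "q - p" "\<sigma> powr q / (4 * K)" "max 1 (2 powr (1 / q) / \<sigma>)"]
      p_less_q \<sigma> K by auto
  have A1: "1 \<le> A" using A by simp
  have KA: "K * A powr (p - q) \<le> \<sigma> powr q / 4"
    using small K by (simp add: field_simps)
  have \<sigma>A: "2 \<le> (\<sigma> * A) powr q"
  proof -
    have "2 powr (1 / q) \<le> \<sigma> * A" using A \<sigma> by (simp add: field_simps)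
    then have "(2 powr (1 / q)) powr q \<le> (\<sigma> * A) powr q" using q_pos by (intro powr_mono2) auto
    then show ?thesis using q_pos by (simp add: powr_powr)
  qed
  define b where "b = A powr q + 4 * K * A powr p / \<sigma> powr q"
  have "b \<ge> 0" using K by (simp add: b_def)
  moreover have "tail_moment t \<le> b * t powr q * tail t" if t: "t \<ge> \<rho> * norm_p" for t
  proof -
    have tpos: "0 < t" using t t0 by simp
    define e where "e = expectation (\<lambda>\<omega>. max t (X \<omega>) powr p - t powr p)"
    have int_maxp: "integrable M (\<lambda>\<omega>. max t (X \<omega>) powr p)"
      using int_max_powr[OF int_p p_pos, of t 1] tpos by simp
    have int_diff: "integrable M (\<lambda>\<omega>. max t (X \<omega>) powr p - t powr p)"
      using int_maxp by simp
    have e0: "0 \<le> e" unfolding e_def using tpos p_pos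
      by (intro integral_nonneg_AE AE_I2) (auto intro!: powr_mono2)
    have eR: "e \<le> R * t powr p"
    proof -
      have "e \<le> expectation (\<lambda>\<omega>. X \<omega> powr p)"
        unfolding e_def by (intro integral_mono int_diff int_p) (auto simp: max_def)
      also have "\<dots> = R * (\<rho> * norm_p) powr p"
        using \<rho> norm_p_pos by (simp add: norm_p_powr R_def powr_mult powr_minus)
      also have "\<dots> \<le> R * t powr p"
        using t t0 R p_pos by (intro mult_left_mono powr_mono2) auto
      finally show ?thesis .
    qed
    have upper: "e \<le> (A * t) powr p * tail t + (A * t) powr (p - q) * tail_moment (A * t)"
    proof -
      have "e \<le> expectation (\<lambda>\<omega>. (A * t) powr p * indicator {t<..} (X \<omega>)
          + (A * t) powr (p - q) * (X \<omega> powr q * indicator {A * t<..} (X \<omega>)))"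
        unfolding e_def
      proof (intro integral_mono int_diff Bochner_Integration.integrable_add
          integrable_mult_right int_indicator int_tail_moment int_q)
        fix \<omega>
        have le: "t \<le> A * t" using A1 tpos by simp
        consider "X \<omega> \<le> t" | "t < X \<omega>" "X \<omega> \<le> A * t" | "A * t < X \<omega>" by linarith
        then show "max t (X \<omega>) powr p - t powr p \<le> (A * t) powr p * indicator {t<..} (X \<omega>)
          + (A * t) powr (p - q) * (X \<omega> powr q * indicator {A * t<..} (X \<omega>))"
        proof cases
          case 1
          then show ?thesis using le by (simp add: max_def)
        next
          case 2
          then have "X \<omega> powr p \<le> (A * t) powr p" using tpos p_pos by (intro powr_mono2) auto
          moreover have "0 \<le> t powr p" by simp
          ultimately show ?thesis using 2 by (simp add: max_def del: powr_ge_zero)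
        next
          case 3
          then have "X \<omega> powr p \<le> (A * t) powr (p - q) * X \<omega> powr q"
            using tpos A1 p_less_q by (intro powr_le_of_scaled_powr) auto
          moreover have "0 \<le> t powr p" "0 \<le> (A * t) powr p" by auto
          ultimately show ?thesis using 3 le by (simp add: max_def del: powr_ge_zero)
        qed
      qed
      also have "\<dots> = (A * t) powr p * tail t + (A * t) powr (p - q) * tail_moment (A * t)"
        using int_indicator int_tail_moment[OF int_q] by (simp add: tail_moment_def tail_eq)
      finally show ?thesis .
    qed
    have "t powr q + \<sigma> powr q / 2 * tail_moment (A * t)
        = expectation (\<lambda>\<omega>. t powr q + \<sigma> powr q / 2 * (X \<omega> powr q * indicator {A * t<..} (X \<omega>)))"
      using int_tail_moment[OF int_q] by (simp add: tail_moment_def prob_space)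
    also have "\<dots> \<le> expectation (\<lambda>\<omega>. max t (\<sigma> * X \<omega>) powr q)"
    proof (intro integral_mono int_max_powr int_q q_pos Bochner_Integration.integrable_add
        integrable_mult_right int_tail_moment)
      fix \<omega> assume \<omega>: "\<omega> \<in> space M"
      show "t powr q + \<sigma> powr q / 2 * (X \<omega> powr q * indicator {A * t<..} (X \<omega>)) \<le> max t (\<sigma> * X \<omega>) powr q"
      proof (cases "A * t < X \<omega>")
        case True
        have "2 * t powr q \<le> (\<sigma> * A) powr q * t powr q"
          using \<sigma>A by (intro mult_right_mono) auto
        also have "\<dots> = (\<sigma> * (A * t)) powr q" using \<sigma> A1 tpos by (simp add: powr_mult)
        also have "\<dots> \<le> (\<sigma> * X \<omega>) powr q"
          using True \<sigma> A1 tpos q_pos by (intro powr_mono2) auto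
        finally have "t powr q + (\<sigma> * X \<omega>) powr q / 2 \<le> (\<sigma> * X \<omega>) powr q" by simp
        also have "\<dots> \<le> max t (\<sigma> * X \<omega>) powr q"
          using \<sigma> X_nonneg[OF \<omega>] q_pos by (intro powr_mono2) auto
        finally show ?thesis using True \<sigma> X_nonneg[OF \<omega>] by (simp add: powr_mult)
      next
        case False
        then show ?thesis using tpos q_pos by (auto intro!: powr_mono2)
      qed
    qed (use tpos \<sigma> in auto)
    also have "\<dots> \<le> expectation (\<lambda>\<omega>. max t (X \<omega>) powr p) powr (q / p)"
      using contr tpos by simp
    also have "expectation (\<lambda>\<omega>. max t (X \<omega>) powr p) = t powr p * (1 + e / t powr p)"
      using int_maxp tpos by (simp add: e_def prob_space field_simps)
    also have "\<dots> powr (q / p) = t powr q * (1 + e / t powr p) powr (q / p)"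
      using p_pos e0 by (simp add: powr_mult powr_powr)
    also have "\<dots> \<le> t powr q * (1 + K * (e / t powr p))"
      unfolding K_def using e0 eR tpos p_pos p_less_q
      by (intro mult_left_mono one_plus_powr_le_linear) (auto simp: field_simps)
    also have "\<dots> = t powr q + K * t powr (q - p) * e"
      using tpos by (simp add: powr_diff field_simps)
    also have "\<dots> \<le> t powr q + K * t powr (q - p) * ((A * t) powr p * tail t
        + (A * t) powr (p - q) * tail_moment (A * t))"
      using upper K by (intro add_left_mono mult_left_mono) auto
    also have "\<dots> = t powr q + (K * A powr p * t powr q * tail t + K * A powr (p - q) * tail_moment (A * t))"
    proof -
      have 1: "t powr (q - p) * (A * t) powr p = A powr p * t powr q"
        using A1 tpos by (simp add: powr_mult powr_diff)
      have 2: "t powr (q - p) * (A * t) powr (p - q) = A powr (p - q)"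
        using A1 tpos by (simp add: powr_mult powr_diff)
      have "K * t powr (q - p) * ((A * t) powr p * tail t + (A * t) powr (p - q) * tail_moment (A * t))
          = K * (t powr (q - p) * (A * t) powr p) * tail t
            + K * (t powr (q - p) * (A * t) powr (p - q)) * tail_moment (A * t)"
        by (simp only: distrib_left mult.assoc)
      also have "\<dots> = K * A powr p * t powr q * tail t + K * A powr (p - q) * tail_moment (A * t)"
        by (simp only: 1 2 mult.assoc)
      finally show ?thesis by (rule arg_cong)
    qed
    also have "\<dots> \<le> t powr q + (K * A powr p * t powr q * tail t + \<sigma> powr q / 4 * tail_moment (A * t))"
      using KA tail_moment_nonneg by (intro add_left_mono mult_right_mono) auto
    finally have "\<sigma> powr q / 4 * tail_moment (A * t) \<le> K * A powr p * t powr q * tail t"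
      by simp
    then have far: "tail_moment (A * t) \<le> 4 * K * A powr p / \<sigma> powr q * t powr q * tail t"
      using \<sigma> by (simp add: field_simps)
    have "tail_moment t \<le> expectation (\<lambda>\<omega>. (A * t) powr q * indicator {t<..} (X \<omega>)
        + X \<omega> powr q * indicator {A * t<..} (X \<omega>))"
      unfolding tail_moment_def using tpos q_pos
      by (intro integral_mono Bochner_Integration.integrable_add integrable_mult_right
          int_indicator int_tail_moment int_q) (auto simp: indicator_def intro!: powr_mono2)
    also have "\<dots> = (A * t) powr q * tail t + tail_moment (A * t)"
      using int_indicator int_tail_moment[OF int_q] by (simp add: tail_moment_def tail_eq)
    also have "\<dots> \<le> b * t powr q * tail t"
      using far A1 tpos by (simp add: b_def powr_mult algebra_simps)
    finally show ?thesis .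
  qed
  ultimately show "\<exists>b\<ge>0. \<forall>t\<ge>\<rho> * norm_p. tail_moment t \<le> b * t powr q * tail t"
    by blast
qed

end

section \<open>Maxima of independent copies\<close>

lemma iid_copies_measurable:
  assumes "iid_copies M X N Y n" "j \<in> {1..n}"
  shows "Y j \<in> borel_measurable N"
proof -
  interpret N: prob_space N using assms by (simp add: iid_copies_def)
  show ?thesis using assms by (simp add: iid_copies_def N.indep_vars_def)
qed

lemma iid_copies_max_upto_measurable:
  assumes "iid_copies M X N Y n"
  shows "max_upto Y n \<in> borel_measurable N"
  unfolding max_upto_def
  using iid_copies_measurable[OF assms] by (intro borel_measurable_Max) auto

lemma iid_copies_nn_integral:
  assumes "iid_copies M X N Y n" "j \<in> {1..n}" "X \<in> borel_measurable M" "h \<in> borel_measurable borel"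
  shows "(\<integral>\<^sup>+\<omega>. h (Y j \<omega>) \<partial>N) = (\<integral>\<^sup>+\<omega>. h (X \<omega>) \<partial>M)"
proof -
  have eq: "distr N borel (Y j) = distr M borel X" using assms by (simp add: iid_copies_def)
  show ?thesis
    using arg_cong[OF eq, of "\<lambda>D. \<integral>\<^sup>+x. h x \<partial>D"] iid_copies_measurable[OF assms(1,2)] assms(3,4)
    by (simp add: nn_integral_distr)
qed

text \<open>
  A copy shares with \<open>X\<close> only its distribution, so pointwise properties such as nonnegativity
  transfer in the almost sure sense.
\<close>

lemma iid_copies_AE:
  assumes "iid_copies M X N Y n" "X \<in> borel_measurable M"
    and "AE \<omega> in M. P (X \<omega>)" and [measurable]: "Measurable.pred borel P"
  shows "AE \<omega> in N. \<forall>j\<in>{1..n}. P (Y j \<omega>)"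
proof -
  have "AE \<omega> in N. P (Y j \<omega>)" if j: "j \<in> {1..n}" for j
  proof -
    have eq: "distr N borel (Y j) = distr M borel X" using assms(1) j by (simp add: iid_copies_def)
    have "AE x in distr M borel X. P x" using assms by (subst AE_distr_iff) auto
    then have "AE x in distr N borel (Y j). P x" by (simp only: eq)
    then show ?thesis using iid_copies_measurable[OF assms(1) j] by (simp add: AE_distr_iff)
  qed
  then show ?thesis by (intro AE_finite_allI) auto
qed

lemma abs_max_upto:
  assumes "\<forall>j\<in>{1..n}. 0 \<le> Y j \<omega>" "1 \<le> n"
  shows "\<forall>j\<in>{1..n}. Y j \<omega> \<le> \<bar>max_upto Y n \<omega>\<bar>" "\<exists>j\<in>{1..n}. \<bar>max_upto Y n \<omega>\<bar> = Y j \<omega>"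
proof -
  have le: "Y j \<omega> \<le> max_upto Y n \<omega>" if "j \<in> {1..n}" for j
    unfolding max_upto_def using that by (intro Max_ge) auto
  then show "\<forall>j\<in>{1..n}. Y j \<omega> \<le> \<bar>max_upto Y n \<omega>\<bar>" by force
  have "max_upto Y n \<omega> \<in> (\<lambda>j. Y j \<omega>) ` {1..n}"
    unfolding max_upto_def using assms(2) by (intro Max_in) auto
  then show "\<exists>j\<in>{1..n}. \<bar>max_upto Y n \<omega>\<bar> = Y j \<omega>" using assms(1) by force
qed

text \<open>
  From \<open>(1 - x)\<^sup>n (1 + x)\<^sup>n \<le> 1\<close> and Bernoulli's inequality \<open>(1 + x)\<^sup>n \<ge> 1 + n x \<ge> 2\<close>.
\<close>

lemma one_minus_power_le_half:
  fixes x :: real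
  assumes "0 \<le> x" "x \<le> 1" "1 \<le> real n * x"
  shows "(1 - x) ^ n \<le> 1 / 2"
proof -
  have "(1 - x) ^ n * 2 \<le> (1 - x) ^ n * (1 + x) ^ n"
    using assms Bernoulli_inequality[of x n] by (intro mult_left_mono) auto
  also have "\<dots> = (1 - x * x) ^ n"
    by (simp add: algebra_simps flip: power_mult_distrib)
  also have "\<dots> \<le> 1" using assms by (intro power_le_one) (auto simp: mult_le_one)
  finally show ?thesis by simp
qed

locale iid_max = nonneg_rv M X p q
  for M :: "'a measure" and X :: "'a \<Rightarrow> real" and p q :: real +
  fixes N :: "'b measure" and Y :: "nat \<Rightarrow> 'b \<Rightarrow> real" and n :: nat
  assumes iid: "iid_copies M X N Y n" and n_pos: "1 \<le> n"
begin

sublocale N: prob_space N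
  using iid by (simp add: iid_copies_def)

text \<open>
  The absolute value is the one inside \<open>Lr_norm\<close>; almost surely it changes nothing.
\<close>

definition Z :: "'b \<Rightarrow> real" where
  "Z \<omega> = \<bar>max_upto Y n \<omega>\<bar>"

lemma Z_measurable [measurable]: "Z \<in> borel_measurable N"
  using iid_copies_max_upto_measurable[OF iid] unfolding Z_def by measurable

lemma Z_nonneg: "0 \<le> Z \<omega>"
  by (simp add: Z_def)

lemma AE_Z: "AE \<omega> in N. (\<forall>j\<in>{1..n}. 0 \<le> Y j \<omega> \<and> Y j \<omega> \<le> Z \<omega>) \<and> (\<exists>j\<in>{1..n}. Z \<omega> = Y j \<omega>)"
proof -
  have "AE \<omega> in N. \<forall>j\<in>{1..n}. 0 \<le> Y j \<omega>"
    using X_nonneg by (intro iid_copies_AE[OF iid rv] AE_I2) auto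
  then show ?thesis
  proof eventually_elim
    case (elim \<omega>)
    then show ?case using abs_max_upto[of n Y \<omega>] n_pos by (auto simp: Z_def)
  qed
qed

lemma copy_integrable_iff:
  fixes h :: "real \<Rightarrow> real"
  assumes "j \<in> {1..n}" "h \<in> borel_measurable borel"
  shows "integrable N (\<lambda>\<omega>. h (Y j \<omega>)) \<longleftrightarrow> integrable M (\<lambda>\<omega>. h (X \<omega>))"
proof -
  have eq: "distr N borel (Y j) = distr M borel X" using assms iid by (simp add: iid_copies_def)
  show ?thesis
    using arg_cong[OF eq, of "\<lambda>D. integrable D h"] iid_copies_measurable[OF iid assms(1)] assms(2)
    by (simp add: integrable_distr_eq)
qed

lemma copy_expectation:
  fixes h :: "real \<Rightarrow> real"
  assumes "j \<in> {1..n}" "h \<in> borel_measurable borel"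
  shows "N.expectation (\<lambda>\<omega>. h (Y j \<omega>)) = expectation (\<lambda>\<omega>. h (X \<omega>))"
proof -
  have eq: "distr N borel (Y j) = distr M borel X" using assms iid by (simp add: iid_copies_def)
  show ?thesis
    using arg_cong[OF eq, of "\<lambda>D. integral\<^sup>L D h"] iid_copies_measurable[OF iid assms(1)] assms(2)
    by (simp add: integral_distr)
qed

lemma sum_copies_expectation:
  fixes h :: "real \<Rightarrow> real"
  assumes "h \<in> borel_measurable borel" "integrable M (\<lambda>\<omega>. h (X \<omega>))"
  shows "integrable N (\<lambda>\<omega>. \<Sum>j=1..n. h (Y j \<omega>))"
    and "N.expectation (\<lambda>\<omega>. \<Sum>j=1..n. h (Y j \<omega>)) = real n * expectation (\<lambda>\<omega>. h (X \<omega>))"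
proof -
  have int: "integrable N (\<lambda>\<omega>. h (Y j \<omega>))" if "j \<in> {1..n}" for j
    using copy_integrable_iff[OF that assms(1)] assms(2) by simp
  then show "integrable N (\<lambda>\<omega>. \<Sum>j=1..n. h (Y j \<omega>))" by auto
  show "N.expectation (\<lambda>\<omega>. \<Sum>j=1..n. h (Y j \<omega>)) = real n * expectation (\<lambda>\<omega>. h (X \<omega>))"
    using int copy_expectation[OF _ assms(1)] by (subst Bochner_Integration.integral_sum) auto
qed

lemma AE_Z_le_sum:
  fixes h :: "real \<Rightarrow> real"
  assumes "\<And>x. 0 \<le> h x"
  shows "AE \<omega> in N. h (Z \<omega>) \<le> (\<Sum>j=1..n. h (Y j \<omega>))"
  using AE_Z
proof eventually_elim
  case (elim \<omega>)
  then obtain j where "j \<in> {1..n}" "Z \<omega> = Y j \<omega>" by auto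
  then show ?case using member_le_sum[of j "{1..n}" "\<lambda>j. h (Y j \<omega>)"] assms by auto
qed

text \<open>
  The union bound: almost surely \<open>Z\<close> is one of the copies, so a nonnegative function of \<open>Z\<close> is at
  most the sum of its values at the copies.
\<close>

lemma expectation_Z_le:
  fixes h :: "real \<Rightarrow> real"
  assumes [measurable]: "h \<in> borel_measurable borel" and "\<And>x. 0 \<le> h x"
    and "integrable M (\<lambda>\<omega>. h (X \<omega>))"
  shows "integrable N (\<lambda>\<omega>. h (Z \<omega>))"
    and "N.expectation (\<lambda>\<omega>. h (Z \<omega>)) \<le> real n * expectation (\<lambda>\<omega>. h (X \<omega>))"
proof -
  note sum = sum_copies_expectation[OF assms(1,3)]
  show int: "integrable N (\<lambda>\<omega>. h (Z \<omega>))"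
  proof (rule Bochner_Integration.integrable_bound[OF sum(1)])
    show "AE \<omega> in N. norm (h (Z \<omega>)) \<le> norm (\<Sum>j=1..n. h (Y j \<omega>))"
      using AE_Z_le_sum[of h, OF assms(2)] by eventually_elim (use assms(2) in auto)
  qed simp
  show "N.expectation (\<lambda>\<omega>. h (Z \<omega>)) \<le> real n * expectation (\<lambda>\<omega>. h (X \<omega>))"
    using integral_mono_AE[OF int sum(1) AE_Z_le_sum] assms(2) sum(2) by simp
qed

lemma int_Z_p: "integrable N (\<lambda>\<omega>. Z \<omega> powr p)"
  using expectation_Z_le(1)[of "\<lambda>x. x powr p"] int_p by simp

lemma int_Z_indicator: "integrable N (\<lambda>\<omega>. indicator {t<..} (Z \<omega>) :: real)"
  by (intro N.integrable_const_bound[where B = 1]) (auto simp: indicator_def)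

lemma moment_le_Z_moment: "expectation (\<lambda>\<omega>. X \<omega> powr p) \<le> N.expectation (\<lambda>\<omega>. Z \<omega> powr p)"
proof -
  have 1: "1 \<in> {1..n}" using n_pos by simp
  have "N.expectation (\<lambda>\<omega>. Y 1 \<omega> powr p) \<le> N.expectation (\<lambda>\<omega>. Z \<omega> powr p)"
  proof (rule integral_mono_AE)
    show "integrable N (\<lambda>\<omega>. Y 1 \<omega> powr p)"
      using copy_integrable_iff[OF 1, of "\<lambda>x. x powr p"] int_p by simp
    show "AE \<omega> in N. Y 1 \<omega> powr p \<le> Z \<omega> powr p"
      using AE_Z by eventually_elim (use 1 p_pos in \<open>auto intro!: powr_mono2\<close>)
  qed (rule int_Z_p)
  then show ?thesis using copy_expectation[OF 1, of "\<lambda>x. x powr p"] by simp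
qed

lemma int_q_of_Z:
  assumes "integrable N (\<lambda>\<omega>. Z \<omega> powr q)"
  shows "integrable M (\<lambda>\<omega>. X \<omega> powr q)"
proof -
  have 1: "1 \<in> {1..n}" using n_pos by simp
  note [measurable] = iid_copies_measurable[OF iid 1]
  have "integrable N (\<lambda>\<omega>. Y 1 \<omega> powr q)"
  proof (rule Bochner_Integration.integrable_bound[OF assms])
    show "AE \<omega> in N. norm (Y 1 \<omega> powr q) \<le> norm (Z \<omega> powr q)"
      using AE_Z by eventually_elim (use 1 q_pos in \<open>auto intro!: powr_mono2\<close>)
  qed measurable
  then show ?thesis using copy_integrable_iff[OF 1, of "\<lambda>x. x powr q"] by simp
qed

lemma Z_tail_le: "N.expectation (\<lambda>\<omega>. indicator {t<..} (Z \<omega>)) \<le> real n * tail t"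
  using expectation_Z_le(2)[of "indicator {t<..}"] int_indicator by (simp add: tail_eq)

lemma Z_moment_le:
  assumes int_q: "integrable M (\<lambda>\<omega>. X \<omega> powr q)" and t: "0 \<le> t"
  shows "N.expectation (\<lambda>\<omega>. Z \<omega> powr q) \<le> t powr q + real n * tail_moment t"
proof -
  have int: "integrable M (\<lambda>\<omega>. X \<omega> powr q * indicator {t<..} (X \<omega>))"
    by (rule int_tail_moment[OF int_q])
  note trunc = expectation_Z_le[of "\<lambda>x. x powr q * indicator {t<..} x", OF _ _ int, simplified]
  have "N.expectation (\<lambda>\<omega>. Z \<omega> powr q)
      \<le> N.expectation (\<lambda>\<omega>. t powr q + Z \<omega> powr q * indicator {t<..} (Z \<omega>))"
    using t Z_nonneg q_pos int_q trunc(1) expectation_Z_le(1)[of "\<lambda>x. x powr q"]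
    by (intro integral_mono Bochner_Integration.integrable_add)
      (auto simp: indicator_def intro!: powr_mono2)
  also have "\<dots> = t powr q + N.expectation (\<lambda>\<omega>. Z \<omega> powr q * indicator {t<..} (Z \<omega>))"
    using trunc(1) by (simp add: N.prob_space)
  also have "\<dots> \<le> t powr q + real n * tail_moment t"
    using trunc(2) by (simp add: tail_moment_def)
  finally show ?thesis .
qed

lemma product_expectation:
  fixes g :: "nat \<Rightarrow> real \<Rightarrow> real"
  assumes "\<And>i. i \<in> {1..n} \<Longrightarrow> g i \<in> borel_measurable borel"
    and "\<And>i. i \<in> {1..n} \<Longrightarrow> integrable M (\<lambda>\<omega>. g i (X \<omega>))"
  shows "integrable N (\<lambda>\<omega>. \<Prod>i=1..n. g i (Y i \<omega>))"
    and "N.expectation (\<lambda>\<omega>. \<Prod>i=1..n. g i (Y i \<omega>)) = (\<Prod>i=1..n. expectation (\<lambda>\<omega>. g i (X \<omega>)))"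
proof -
  have indep: "N.indep_vars (\<lambda>_. borel) (\<lambda>i \<omega>. g i (Y i \<omega>)) {1..n}"
  proof (rule N.indep_vars_compose2[where M' = "\<lambda>_. borel" and X = Y])
    show "N.indep_vars (\<lambda>_. borel) Y {1..n}" using iid by (simp add: iid_copies_def)
  qed (rule assms(1))
  have int: "integrable N (\<lambda>\<omega>. g i (Y i \<omega>))" if "i \<in> {1..n}" for i
    using copy_integrable_iff[OF that assms(1)] assms(2) that by blast
  show "integrable N (\<lambda>\<omega>. \<Prod>i=1..n. g i (Y i \<omega>))"
    by (rule N.indep_vars_integrable[OF _ indep int]) auto
  have "N.expectation (\<lambda>\<omega>. \<Prod>i=1..n. g i (Y i \<omega>)) = (\<Prod>i=1..n. N.expectation (\<lambda>\<omega>. g i (Y i \<omega>)))"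
    by (rule N.indep_vars_lebesgue_integral[OF _ indep int]) auto
  also have "\<dots> = (\<Prod>i=1..n. expectation (\<lambda>\<omega>. g i (X \<omega>)))"
    using copy_expectation[OF _ assms(1)] by (intro prod.cong) auto
  finally show "N.expectation (\<lambda>\<omega>. \<Prod>i=1..n. g i (Y i \<omega>)) = (\<Prod>i=1..n. expectation (\<lambda>\<omega>. g i (X \<omega>)))" .
qed

lemma Z_tail_ge_half:
  assumes "1 \<le> real n * tail t"
  shows "1 / 2 \<le> N.expectation (\<lambda>\<omega>. indicator {t<..} (Z \<omega>) :: real)"
proof -
  note prod = product_expectation[of "\<lambda>_. indicator {..t}"]
  have int: "integrable N (\<lambda>\<omega>. \<Prod>i=1..n. indicator {..t} (Y i \<omega>) :: real)"
    using int_indicator_atMost by (intro prod(1)) auto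
  have "1 - (1 - tail t) ^ n = 1 - N.expectation (\<lambda>\<omega>. \<Prod>i=1..n. indicator {..t} (Y i \<omega>))"
    using int_indicator_atMost by (subst prod(2)) (auto simp: expectation_indicator_atMost)
  also have "\<dots> = N.expectation (\<lambda>\<omega>. 1 - (\<Prod>i=1..n. indicator {..t} (Y i \<omega>)))"
    using int by (simp add: N.prob_space)
  also have "\<dots> \<le> N.expectation (\<lambda>\<omega>. indicator {t<..} (Z \<omega>))"
  proof (rule integral_mono_AE)
    show "AE \<omega> in N. 1 - (\<Prod>i=1..n. indicator {..t} (Y i \<omega>)) \<le> (indicator {t<..} (Z \<omega>) :: real)"
      using AE_Z
    proof eventually_elim
      case (elim \<omega>)
      show ?case
      proof (cases "t < Z \<omega>")
        case True
        have "0 \<le> (\<Prod>i=1..n. indicator {..t} (Y i \<omega>) :: real)" by (intro prod_nonneg) auto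
        then show ?thesis using True by simp
      next
        case False
        then have "indicator {..t} (Y i \<omega>) = (1 :: real)" if "i \<in> {1..n}" for i
          using elim that by force
        then show ?thesis by simp
      qed
    qed
  qed (use int int_Z_indicator in auto)
  finally show ?thesis
    using one_minus_power_le_half[OF tail_nonneg tail_le_1 assms] by linarith
qed

text \<open>
  The events that the \<open>j\<close>-th copy exceeds \<open>t\<close> while all others stay below \<open>t\<close> are disjoint, and on
  the \<open>j\<close>-th of them \<open>Z\<close> is at least the \<open>j\<close>-th copy. By independence each contributes
  \<open>tail_moment t * (1 - tail t) ^ (n - 1)\<close>, where the power is at least \<open>1 / 2\<close> by Bernoulli's
  inequality.
\<close>

lemma Z_moment_ge:
  assumes int_q: "integrable M (\<lambda>\<omega>. X \<omega> powr q)" and small: "real n * tail t \<le> 1 / 2"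
  shows "real n * tail_moment t \<le> 2 * N.expectation (\<lambda>\<omega>. Z \<omega> powr q)"
proof -
  \<comment> \<open>The product of \<open>g j i\<close> over \<open>i\<close>, taken at the copies, is the \<open>q\<close>-th power of the \<open>j\<close>-th copy on the \<open>j\<close>-th event.\<close>
  define g where "g j i x = (if i = j then x powr q * indicator {t<..} x else indicator {..t} x)"
    for j i :: nat and x :: real
  have g_meas: "g j i \<in> borel_measurable borel" for j i
  proof -
    have "g j i = (if i = j then (\<lambda>x. x powr q * indicator {t<..} x) else indicator {..t})"
      by (auto simp: g_def)
    then show ?thesis by simp
  qed
  have g_int: "integrable M (\<lambda>\<omega>. g j i (X \<omega>))" for j i
    unfolding g_def using int_tail_moment[OF int_q] int_indicator_atMost by (cases "i = j") auto
  have g0: "0 \<le> g j i x" for j i x by (simp add: g_def)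
  have prod: "integrable N (\<lambda>\<omega>. \<Prod>i=1..n. g j i (Y i \<omega>))"
    "N.expectation (\<lambda>\<omega>. \<Prod>i=1..n. g j i (Y i \<omega>)) = (\<Prod>i=1..n. expectation (\<lambda>\<omega>. g j i (X \<omega>)))"
    for j using product_expectation[of "g j", OF g_meas g_int] by simp_all
  have factor: "(\<Prod>i=1..n. expectation (\<lambda>\<omega>. g j i (X \<omega>))) \<ge> tail_moment t / 2" if j: "j \<in> {1..n}" for j
  proof -
    have "(\<Prod>i=1..n. expectation (\<lambda>\<omega>. g j i (X \<omega>)))
        = expectation (\<lambda>\<omega>. g j j (X \<omega>)) * (\<Prod>i\<in>{1..n} - {j}. expectation (\<lambda>\<omega>. g j i (X \<omega>)))"
      using j by (intro prod.remove) auto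
    also have "\<dots> = tail_moment t * (1 - tail t) ^ (n - 1)"
      using j by (simp add: g_def tail_moment_def expectation_indicator_atMost)
    also have "\<dots> \<ge> tail_moment t * (1 / 2)"
    proof (intro mult_left_mono tail_moment_nonneg)
      have "real (n - 1) * tail t \<le> real n * tail t" using tail_nonneg by (intro mult_right_mono) auto
      then show "1 / 2 \<le> (1 - tail t) ^ (n - 1)"
        using Bernoulli_inequality[of "- tail t" "n - 1"] small tail_le_1[of t] by simp
    qed
    finally show ?thesis by simp
  qed
  have "(\<Sum>j=1..n. tail_moment t / 2) \<le> (\<Sum>j=1..n. N.expectation (\<lambda>\<omega>. \<Prod>i=1..n. g j i (Y i \<omega>)))"
    by (intro sum_mono) (simp only: prod(2) factor)
  also have "\<dots> = N.expectation (\<lambda>\<omega>. \<Sum>j=1..n. \<Prod>i=1..n. g j i (Y i \<omega>))"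
    using prod(1) by (intro Bochner_Integration.integral_sum[symmetric]) auto
  also have "\<dots> \<le> N.expectation (\<lambda>\<omega>. Z \<omega> powr q)"
  proof (rule integral_mono_AE)
    show "AE \<omega> in N. (\<Sum>j=1..n. \<Prod>i=1..n. g j i (Y i \<omega>)) \<le> Z \<omega> powr q"
      using AE_Z
    proof eventually_elim
      case (elim \<omega>)
      show ?case
      proof (cases "\<exists>j\<in>{1..n}. t < Y j \<omega>")
        case True
        then obtain j where j: "j \<in> {1..n}" "t < Y j \<omega>" by blast
        have "(\<Prod>i=1..n. g k i (Y i \<omega>)) = 0" if "k \<in> {1..n} - {j}" for k
          using that j by (intro prod_zero bexI[of _ j]) (auto simp: g_def)
        then have "(\<Sum>k\<in>{1..n} - {j}. \<Prod>i=1..n. g k i (Y i \<omega>)) = 0"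
          by (intro sum.neutral) blast
        then have "(\<Sum>k=1..n. \<Prod>i=1..n. g k i (Y i \<omega>)) = (\<Prod>i=1..n. g j i (Y i \<omega>))"
          using sum.remove[OF finite_atLeastAtMost j(1), of "\<lambda>k. \<Prod>i=1..n. g k i (Y i \<omega>)"]
          by linarith
        also have "\<dots> = g j j (Y j \<omega>) * (\<Prod>i\<in>{1..n} - {j}. g j i (Y i \<omega>))"
          using j by (intro prod.remove) auto
        also have "\<dots> \<le> g j j (Y j \<omega>) * 1"
          using g0 by (intro mult_left_mono prod_le_1) (auto simp: g_def indicator_def)
        also have "\<dots> \<le> Z \<omega> powr q"
          using elim j q_pos by (auto simp: g_def intro!: powr_mono2)
        finally show ?thesis .
      next
        case False
        then have "(\<Prod>i=1..n. g k i (Y i \<omega>)) = 0" if "k \<in> {1..n}" for k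
          using that by (intro prod_zero bexI[of _ k]) (auto simp: g_def)
        then have "(\<Sum>k=1..n. \<Prod>i=1..n. g k i (Y i \<omega>)) = 0" by (intro sum.neutral) blast
        then show ?thesis by (simp only: powr_ge_zero)
      qed
    qed
    show "integrable N (\<lambda>\<omega>. Z \<omega> powr q)"
      using expectation_Z_le(1)[of "\<lambda>x. x powr q"] int_q by simp
  qed (use prod(1) in auto)
  finally show ?thesis by simp
qed


text \<open>
  Take \<open>t = 2\<^sup>k norm_p\<close> with \<open>k\<close> least such that \<open>n tail t \<le> 1\<close>. Then the bound on the tail moment
  gives \<open>E Z\<^sup>q \<le> (1 + b) t\<^sup>q\<close>. Conversely \<open>E Z\<^sup>p\<close> is at least of the order \<open>t\<^sup>p\<close>: for \<open>k = 0\<close>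
  because \<open>Z\<close> dominates a copy of \<open>X\<close>, and for \<open>k > 0\<close> because minimality of \<open>k\<close> means
  \<open>n tail (t / 2) > 1\<close>, so that \<open>Z > t / 2\<close> has probability at least \<open>1 / 2\<close>.
\<close>

lemma Z_norm_comparison:
  assumes int_q: "integrable M (\<lambda>\<omega>. X \<omega> powr q)" and b: "0 \<le> b"
    and bound: "\<And>t. norm_p \<le> t \<Longrightarrow> tail_moment t \<le> b * t powr q * tail t"
  shows "N.expectation (\<lambda>\<omega>. Z \<omega> powr q)
    \<le> (1 + b) * 2 powr (q + q / p) * N.expectation (\<lambda>\<omega>. Z \<omega> powr p) powr (q / p)"
proof -
  let ?V = "N.expectation (\<lambda>\<omega>. Z \<omega> powr p)"
  define k where "k = (LEAST k. real n * tail (2 ^ k * norm_p) \<le> 1)"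
  define t where "t = 2 ^ k * norm_p"
  have "\<exists>k. real n * tail (2 ^ k * norm_p) \<le> 1"
  proof -
    have "(2::real) powr (- p) < 1" using p_pos powr_less_mono[of "- p" 0 2] by simp
    then obtain k where k: "(2 powr (- p)) ^ k < 1 / real n"
      using n_pos real_arch_pow_inv[of "1 / real n" "2 powr (- p)"] by auto
    have "tail (2 ^ k * norm_p) \<le> (norm_p / (2 ^ k * norm_p)) powr p"
      using norm_p_pos by (intro markov_p) simp
    also have "\<dots> = (1 / 2 ^ k) powr p" using norm_p_pos by simp
    also have "\<dots> = (2 powr (- real k)) powr p"
      by (simp add: powr_minus powr_realpow divide_inverse)
    also have "\<dots> = 2 powr (- p * real k)" by (simp add: powr_powr mult.commute)
    also have "\<dots> = (2 powr (- p)) powr real k" by (simp only: powr_powr)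
    also have "\<dots> = (2 powr (- p)) ^ k" by (rule powr_realpow) simp
    finally have "tail (2 ^ k * norm_p) \<le> 1 / real n" using k by simp
    then show ?thesis using n_pos by (auto simp: field_simps)
  qed
  then have nt: "real n * tail t \<le> 1" unfolding k_def t_def by (rule LeastI_ex)
  have "norm_p \<le> t" using norm_p_pos by (simp add: t_def)
  then have tpos: "0 < t" using norm_p_pos by simp
  have V: "0 \<le> ?V" by (intro integral_nonneg_AE) auto
  have tV: "t powr q \<le> 2 powr (q + q / p) * ?V powr (q / p)"
  proof (cases k)
    case 0
    then have "t powr q = expectation (\<lambda>\<omega>. X \<omega> powr p) powr (q / p)"
      using p_pos moment_pos by (simp add: t_def norm_p_def powr_powr)
    also have "\<dots> \<le> ?V powr (q / p)"
      using moment_le_Z_moment moment_pos p_pos q_pos by (intro powr_mono2) auto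
    also have "\<dots> \<le> 2 powr (q + q / p) * ?V powr (q / p)"
      using p_pos q_pos ge_one_powr_ge_zero[of 2 "q + q / p"]
        mult_right_mono[of 1 "2 powr (q + q / p)" "?V powr (q / p)"] by simp
    finally show ?thesis .
  next
    case (Suc j)
    then have "j < (LEAST k. real n * tail (2 ^ k * norm_p) \<le> 1)" by (simp add: k_def)
    then have "\<not> real n * tail (2 ^ j * norm_p) \<le> 1" by (rule not_less_Least)
    then have big: "1 \<le> real n * tail (t / 2)" using Suc by (simp add: t_def)
    have "(t / 2) powr p * (1 / 2) \<le> (t / 2) powr p * N.expectation (\<lambda>\<omega>. indicator {t / 2<..} (Z \<omega>))"
      using Z_tail_ge_half[OF big] by (intro mult_left_mono) auto
    also have "\<dots> = N.expectation (\<lambda>\<omega>. (t / 2) powr p * indicator {t / 2<..} (Z \<omega>))"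
      by simp
    also have "\<dots> \<le> ?V"
      using tpos p_pos by (intro integral_mono int_Z_p integrable_mult_right int_Z_indicator)
        (auto simp: indicator_def intro!: powr_mono2)
    finally have "((t / 2) powr p) powr (q / p) \<le> (2 * ?V) powr (q / p)"
      using p_pos q_pos by (intro powr_mono2) auto
    then have "2 powr q * (t / 2) powr q \<le> 2 powr q * (2 powr (q / p) * ?V powr (q / p))"
      using p_pos V by (simp add: powr_powr powr_mult)
    then show ?thesis using tpos by (simp add: powr_divide powr_add mult.assoc)
  qed
  have "N.expectation (\<lambda>\<omega>. Z \<omega> powr q) \<le> t powr q + real n * tail_moment t"
    using tpos by (intro Z_moment_le int_q) simp
  also have "\<dots> \<le> t powr q + real n * (b * t powr q * tail t)"
    using bound[OF \<open>norm_p \<le> t\<close>] by (intro add_left_mono mult_left_mono) auto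
  also have "\<dots> = t powr q * (1 + b * (real n * tail t))" by (simp add: algebra_simps)
  also have "\<dots> \<le> t powr q * (1 + b * 1)"
    using nt b by (intro mult_left_mono add_left_mono) auto
  also have "\<dots> = (1 + b) * t powr q" by simp
  also have "\<dots> \<le> (1 + b) * (2 powr (q + q / p) * ?V powr (q / p))"
    using tV b by (intro mult_left_mono) auto
  finally show ?thesis by (simp add: mult.assoc)
qed

text \<open>
  With \<open>L\<close> the \<open>p\<close>-norm of \<open>Z\<close>, split
  \<open>Z\<^sup>p \<le> t\<^sup>p + (A L)\<^sup>p I(Z > t) + (A L)\<^bsup>p-q\<^esup> Z\<^sup>q\<close>. By the smallness of \<open>P(Z > t)\<close> and the
  comparison of norms, the last two terms have expectations at most \<open>L\<^sup>p / 4\<close> each; hence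
  \<open>L\<^sup>p \<le> 2 t\<^sup>p\<close>, the comparison bounds \<open>E Z\<^sup>q\<close> by a multiple of \<open>t\<^sup>q\<close>, and \<open>Z_moment_ge\<close> bounds
  the tail moment.
\<close>

lemma tail_moment_le_of_norm_comparison:
  assumes int_Z: "integrable N (\<lambda>\<omega>. Z \<omega> powr q)" and C: "0 \<le> C"
    and comp: "N.expectation (\<lambda>\<omega>. Z \<omega> powr q) \<le> C * N.expectation (\<lambda>\<omega>. Z \<omega> powr p) powr (q / p)"
    and A: "0 < A" "C * A powr (p - q) \<le> 1 / 4"
    and \<delta>: "A powr p * \<delta> \<le> 1 / 4" "\<delta> \<le> 1 / 2"
    and t: "0 \<le> t" "real n * tail t \<le> \<delta>"
  shows "real n * tail_moment t \<le> 2 * C * 2 powr (q / p) * t powr q"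
proof -
  let ?V = "N.expectation (\<lambda>\<omega>. Z \<omega> powr p)"
  define L where "L = ?V powr (1 / p)"
  have Vpos: "0 < ?V" using moment_le_Z_moment moment_pos by linarith
  have Lpos: "0 < L" using Vpos by (simp add: L_def)
  have Lp: "L powr p = ?V" and Lq: "L powr q = ?V powr (q / p)"
    using Vpos p_pos by (simp_all add: L_def powr_powr)
  have "?V \<le> N.expectation (\<lambda>\<omega>. t powr p + (A * L) powr p * indicator {t<..} (Z \<omega>)
      + (A * L) powr (p - q) * Z \<omega> powr q)"
  proof (intro integral_mono int_Z_p Bochner_Integration.integrable_add
      integrable_mult_right int_Z_indicator int_Z)
    fix \<omega>
    have nonneg: "0 \<le> t powr p" "0 \<le> (A * L) powr p" "0 \<le> (A * L) powr (p - q) * Z \<omega> powr q" by auto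
    consider "Z \<omega> \<le> t" | "t < Z \<omega>" "Z \<omega> \<le> A * L" | "t < Z \<omega>" "A * L \<le> Z \<omega>" by linarith
    then show "Z \<omega> powr p \<le> t powr p + (A * L) powr p * indicator {t<..} (Z \<omega>)
        + (A * L) powr (p - q) * Z \<omega> powr q"
    proof cases
      case 1
      then have "Z \<omega> powr p \<le> t powr p" using Z_nonneg p_pos by (intro powr_mono2) auto
      then show ?thesis using 1 nonneg by (simp del: powr_ge_zero)
    next
      case 2
      then have "Z \<omega> powr p \<le> (A * L) powr p" using Z_nonneg p_pos by (intro powr_mono2) auto
      moreover have one: "indicator {t<..} (Z \<omega>) = (1::real)" using 2 by simp
      ultimately show ?thesis using nonneg unfolding one mult_1_right by linarith
    next
      case 3
      then have "Z \<omega> powr p \<le> (A * L) powr (p - q) * Z \<omega> powr q"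
        using A Lpos p_less_q by (intro powr_le_of_scaled_powr) auto
      moreover have one: "indicator {t<..} (Z \<omega>) = (1::real)" using 3 by simp
      ultimately show ?thesis using nonneg unfolding one mult_1_right by linarith
    qed
  qed auto
  also have "\<dots> = t powr p + (A * L) powr p * N.expectation (\<lambda>\<omega>. indicator {t<..} (Z \<omega>))
      + (A * L) powr (p - q) * N.expectation (\<lambda>\<omega>. Z \<omega> powr q)"
    using int_Z int_Z_indicator by (simp add: N.prob_space)
  also have "\<dots> \<le> t powr p + (A * L) powr p * \<delta> + (A * L) powr (p - q) * (C * L powr q)"
    using Z_tail_le[of t] t comp unfolding Lq
    by (intro add_mono mult_left_mono order_refl) auto
  also have "\<dots> = t powr p + (A powr p * \<delta>) * ?V + (C * A powr (p - q)) * ?V"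
    unfolding Lp[symmetric] using A Lpos by (simp add: powr_mult powr_diff)
  also have "\<dots> \<le> t powr p + 1 / 4 * ?V + 1 / 4 * ?V"
    using A \<delta> Vpos by (intro add_mono mult_right_mono order_refl) auto
  finally have V: "?V \<le> 2 * t powr p" by simp
  have "real n * tail_moment t \<le> 2 * N.expectation (\<lambda>\<omega>. Z \<omega> powr q)"
    using t \<delta> by (intro Z_moment_ge int_q_of_Z int_Z) auto
  also have "\<dots> \<le> 2 * (C * ?V powr (q / p))" using comp by simp
  also have "\<dots> \<le> 2 * (C * (2 * t powr p) powr (q / p))"
    using V Vpos C p_pos q_pos by (intro mult_left_mono powr_mono2) auto
  also have "\<dots> = 2 * C * 2 powr (q / p) * t powr q"
    using p_pos by (simp add: powr_mult powr_powr)
  finally show ?thesis .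
qed

end

context nonneg_rv
begin

text \<open>
  Real-valued form of (i), raised to the power \<open>q\<close>.
\<close>

definition maxima_comparable :: "(nat \<Rightarrow> 'b measure) \<Rightarrow> (nat \<Rightarrow> nat \<Rightarrow> 'b \<Rightarrow> real) \<Rightarrow> bool" where
  "maxima_comparable N Y \<longleftrightarrow> (\<exists>C>0. \<forall>n\<ge>1.
    integrable (N n) (\<lambda>\<omega>. \<bar>max_upto (Y n) n \<omega>\<bar> powr q) \<and>
    (\<integral>\<omega>. \<bar>max_upto (Y n) n \<omega>\<bar> powr q \<partial>N n)
      \<le> C powr q * (\<integral>\<omega>. \<bar>max_upto (Y n) n \<omega>\<bar> powr p \<partial>N n) powr (q / p))"

lemma iid_maxI:
  "iid_copies M X N Y n \<Longrightarrow> 1 \<le> n \<Longrightarrow> iid_max M X p q N Y n"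
  by unfold_locales

lemma tail_moment_bounded_imp_maxima_comparable:
  assumes iid: "\<And>n. n \<ge> 1 \<Longrightarrow> iid_copies M X (N n) (Y n) n" and tail_moment_bounded
  shows "maxima_comparable N Y"
proof -
  have int_q: "integrable M (\<lambda>\<omega>. X \<omega> powr q)"
    using assms(2) by (simp add: tail_moment_bounded_def)
  obtain b where b: "0 \<le> b" and bound: "\<And>t. norm_p \<le> t \<Longrightarrow> tail_moment t \<le> b * t powr q * tail t"
    using assms(2) unfolding tail_moment_bounded_def by (metis mult_1 zero_less_one)
  define C where "C = ((1 + b) * 2 powr (q + q / p)) powr (1 / q)"
  have C: "0 < C" "C powr q = (1 + b) * 2 powr (q + q / p)"
    using b q_pos by (auto simp: C_def powr_powr)
  show ?thesis
    unfolding maxima_comparable_def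
  proof (intro exI conjI allI impI)
    fix n :: nat assume n: "1 \<le> n"
    interpret iid_max M X p q "N n" "Y n" n by (rule iid_maxI[OF iid[OF n] n])
    show "integrable (N n) (\<lambda>\<omega>. \<bar>max_upto (Y n) n \<omega>\<bar> powr q)"
      using expectation_Z_le(1)[of "\<lambda>x. x powr q"] int_q by (simp add: Z_def)
    show "(\<integral>\<omega>. \<bar>max_upto (Y n) n \<omega>\<bar> powr q \<partial>N n)
      \<le> C powr q * (\<integral>\<omega>. \<bar>max_upto (Y n) n \<omega>\<bar> powr p \<partial>N n) powr (q / p)"
      using Z_norm_comparison[OF int_q b bound] by (simp add: Z_def C(2))
  qed (rule C(1))
qed

lemma tail_moment_eq_0:
  assumes "tail t = 0"
  shows "tail_moment t = 0"
proof -
  have "AE \<omega> in M. \<not> t < X \<omega>"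
    using assms by (subst AE_iff_measurable[OF _ refl]) (auto simp: tail_def emeasure_eq_measure)
  then have "AE \<omega> in M. X \<omega> powr q * indicator {t<..} (X \<omega>) = 0" by eventually_elim simp
  then show ?thesis unfolding tail_moment_def by (rule integral_eq_zero_AE)
qed

text \<open>
  If \<open>tail t\<close> is small, the comparison is applied with \<open>n\<close> about \<open>\<delta> / tail t\<close>, which gives
  \<open>tail_moment t \<le> K t\<^sup>q / n\<close>, that is, a multiple of \<open>t\<^sup>q tail t\<close>. If \<open>tail t \<ge> \<delta> / 2\<close>, there may be no
  such \<open>n\<close>; but then \<open>t\<^sup>q tail t\<close> is bounded below on \<open>t \<ge> \<rho> norm_p\<close>, and the full
  \<open>q\<close>-th moment, finite by the case \<open>n = 1\<close>, serves as the bound.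
\<close>

lemma maxima_comparable_imp_tail_moment_bounded:
  assumes iid: "\<And>n. n \<ge> 1 \<Longrightarrow> iid_copies M X (N n) (Y n) n" and "maxima_comparable N Y"
  shows tail_moment_bounded
proof -
  obtain C0 where C0: "0 < C0" and comp: "\<And>n. 1 \<le> n \<Longrightarrow>
      integrable (N n) (\<lambda>\<omega>. \<bar>max_upto (Y n) n \<omega>\<bar> powr q) \<and>
      (\<integral>\<omega>. \<bar>max_upto (Y n) n \<omega>\<bar> powr q \<partial>N n)
        \<le> C0 powr q * (\<integral>\<omega>. \<bar>max_upto (Y n) n \<omega>\<bar> powr p \<partial>N n) powr (q / p)"
    using assms(2) unfolding maxima_comparable_def by blast
  define C where "C = C0 powr q"
  have C: "0 < C" using C0 by (simp add: C_def)
  obtain A where A: "1 \<le> A" "A powr (- (q - p)) < 1 / (4 * C)"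
    using ex_large_powr_neg_small[of "q - p" "1 / (4 * C)" 1] p_less_q C by auto
  define \<delta> where "\<delta> = min (1 / 2) (1 / (4 * A powr p))"
  have \<delta>: "0 < \<delta>" "\<delta> \<le> 1 / 2" using A by (auto simp: \<delta>_def)
  have A\<delta>: "A powr p * \<delta> \<le> 1 / 4"
  proof -
    have "A powr p * \<delta> \<le> A powr p * (1 / (4 * A powr p))"
      by (intro mult_left_mono) (auto simp: \<delta>_def)
    then show ?thesis using A by simp
  qed
  define K where "K = 2 * C * 2 powr (q / p)"
  have K: "0 < K" using C by (simp add: K_def)
  have key: "real n * tail_moment t \<le> K * t powr q" if n: "1 \<le> n" and t: "0 \<le> t" "real n * tail t \<le> \<delta>" for n t
  proof -
    interpret iid_max M X p q "N n" "Y n" n by (rule iid_maxI[OF iid[OF n] n])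
    show ?thesis
      unfolding K_def using comp[OF n] A C A\<delta> \<delta> t
      by (intro tail_moment_le_of_norm_comparison[where A = A and \<delta> = \<delta>])
        (auto simp: Z_def[abs_def] C_def field_simps)
  qed
  have int_q: "integrable M (\<lambda>\<omega>. X \<omega> powr q)"
  proof -
    interpret iid_max M X p q "N 1" "Y 1" 1 by (rule iid_maxI[OF iid]) auto
    show ?thesis using comp[OF order_refl] by (intro int_q_of_Z) (simp only: Z_def)
  qed
  show ?thesis
    unfolding tail_moment_bounded_def
  proof (intro conjI allI impI int_q)
    fix \<rho> :: real assume \<rho>: "0 < \<rho>"
    define t0 where "t0 = \<rho> * norm_p"
    have t0: "0 < t0" using \<rho> norm_p_pos by (simp add: t0_def)
    define J where "J = expectation (\<lambda>\<omega>. X \<omega> powr q)"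
    have J: "0 \<le> J" unfolding J_def by (intro integral_nonneg_AE) auto
    define b where "b = 2 / \<delta> * max K (J / t0 powr q)"
    have b: "0 \<le> b" using \<delta> K by (simp add: b_def)
    have "tail_moment t \<le> b * t powr q * tail t" if t: "t \<ge> t0" for t
    proof -
      have tpos: "0 < t" using t t0 by simp
      consider "tail t = 0" | "\<delta> / 2 \<le> tail t" | "0 < tail t" "tail t < \<delta> / 2"
        using tail_nonneg[of t] by linarith
      then show ?thesis
      proof cases
        case 1
        then show ?thesis by (simp add: tail_moment_eq_0)
      next
        case 2
        have "tail_moment t \<le> J"
          unfolding tail_moment_def J_def
          by (intro integral_mono int_tail_moment int_q) (auto simp: indicator_def)
        also have "J = J / t0 powr q * t0 powr q" using t0 by simp
        also have "\<dots> \<le> max K (J / t0 powr q) * t powr q"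
          using t t0 q_pos J K by (intro mult_mono powr_mono2) auto
        also have "\<dots> \<le> max K (J / t0 powr q) * t powr q * (2 / \<delta> * tail t)"
        proof -
          have "1 \<le> 2 / \<delta> * tail t" using 2 \<delta> by (simp add: field_simps)
          then show ?thesis
            using K mult_left_mono[of 1 "2 / \<delta> * tail t" "max K (J / t0 powr q) * t powr q"] by simp
        qed
        finally show ?thesis by (simp add: b_def mult_ac)
      next
        case 3
        define n where "n = nat \<lfloor>\<delta> / tail t\<rfloor>"
        have two: "2 \<le> \<delta> / tail t" using 3 by (simp add: field_simps)
        then have n: "1 \<le> n" "real n \<le> \<delta> / tail t" "\<delta> / tail t < real n + 1"
          unfolding n_def by linarith+
        have "real n * tail t \<le> \<delta>" using n(2) 3 by (simp add: field_simps)
        then have "real n * tail_moment t \<le> K * t powr q" using key[OF n(1)] tpos by simp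
        then have "tail_moment t \<le> K * t powr q / real n" using n(1) by (simp add: field_simps)
        also have "\<dots> \<le> K * t powr q * (2 / \<delta> * tail t)"
        proof -
          \<comment> \<open>Rounding down loses at most a factor two, as \<open>n \<ge> 1\<close>.\<close>
          have "\<delta> / tail t \<le> 2 * real n" using n two by linarith
          then have "1 / real n \<le> 2 / \<delta> * tail t" using n(1) 3 \<delta> by (simp add: field_simps)
          then have "K * t powr q * (1 / real n) \<le> K * t powr q * (2 / \<delta> * tail t)"
            using K by (intro mult_left_mono) auto
          then show ?thesis by simp
        qed
        also have "\<dots> \<le> max K (J / t0 powr q) * t powr q * (2 / \<delta> * tail t)"
          using \<delta> tail_nonneg by (intro mult_right_mono) auto
        finally show ?thesis by (simp add: b_def mult_ac)
      qed
    qed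
    with b show "\<exists>b\<ge>0. \<forall>t\<ge>\<rho> * norm_p. tail_moment t \<le> b * t powr q * tail t"
      unfolding t0_def by blast
  qed
qed

end

section \<open>The equivalence\<close>

context nonneg_rv
begin

lemma Lr_norm_p: "Lr_norm M p X = ennreal norm_p"
proof -
  have eq: "expectation (\<lambda>\<omega>. \<bar>X \<omega>\<bar> powr p) = expectation (\<lambda>\<omega>. X \<omega> powr p)"
    using X_nonneg by (intro Bochner_Integration.integral_cong) auto
  have "integrable M (\<lambda>\<omega>. \<bar>X \<omega>\<bar> powr p) \<longleftrightarrow> integrable M (\<lambda>\<omega>. X \<omega> powr p)"
    using X_nonneg by (intro Bochner_Integration.integrable_cong) auto
  then show ?thesis using int_p by (subst Lr_norm_eq) (simp_all add: eq norm_p_def)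
qed

lemma threshold_iff: "0 < \<rho> \<Longrightarrow> 0 \<le> t \<Longrightarrow> ennreal \<rho> * Lr_norm M p X \<le> ennreal t \<longleftrightarrow> \<rho> * norm_p \<le> t"
  using norm_p_pos by (simp add: Lr_norm_p flip: ennreal_mult)

lemma nn_tail_moment_le_iff:
  assumes "0 \<le> t" "0 \<le> c"
  shows "(\<integral>\<^sup>+ \<omega>. ennreal (X \<omega> powr q * indicator {\<omega>. X \<omega> > t} \<omega>) \<partial>M) \<le> ennreal c \<longleftrightarrow>
    integrable M (\<lambda>\<omega>. X \<omega> powr q) \<and> tail_moment t \<le> c" (is "?I \<le> _ \<longleftrightarrow> _")
proof -
  have I: "?I = (\<integral>\<^sup>+ \<omega>. ennreal (X \<omega> powr q * indicator {t<..} (X \<omega>)) \<partial>M)"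
    by (intro nn_integral_cong) (auto simp: indicator_def)
  have "?I = ennreal (tail_moment t)" if "integrable M (\<lambda>\<omega>. X \<omega> powr q)"
    unfolding I tail_moment_def using that by (intro nn_integral_eq_integral int_tail_moment) auto
  then show ?thesis
    using assms nn_tail_moment_le_imp[of t c] I by (auto simp: ennreal_leI)
qed

lemma tail_moment_bounded_iff:
  "(\<forall>\<rho>>0. \<exists>B\<ge>0. \<forall>t\<ge>0. ennreal \<rho> * Lr_norm M p X \<le> ennreal t \<longrightarrow>
      (\<integral>\<^sup>+ \<omega>. ennreal (X \<omega> powr q * indicator {\<omega>. X \<omega> > t} \<omega>) \<partial>M)
        \<le> ennreal (B powr q * t powr q * measure M {\<omega>\<in>space M. X \<omega> > t})) \<longleftrightarrow> tail_moment_bounded"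
    (is "?L \<longleftrightarrow> _")
proof -
  have step: "(\<forall>t\<ge>0. ennreal \<rho> * Lr_norm M p X \<le> ennreal t \<longrightarrow>
      (\<integral>\<^sup>+ \<omega>. ennreal (X \<omega> powr q * indicator {\<omega>. X \<omega> > t} \<omega>) \<partial>M)
        \<le> ennreal (B powr q * t powr q * measure M {\<omega>\<in>space M. X \<omega> > t})) \<longleftrightarrow>
      integrable M (\<lambda>\<omega>. X \<omega> powr q) \<and> (\<forall>t\<ge>\<rho> * norm_p. tail_moment t \<le> B powr q * t powr q * tail t)"
    (is "?A \<longleftrightarrow> _") if \<rho>: "0 < \<rho>" for \<rho> B
  proof -
    have t0: "0 < \<rho> * norm_p" using \<rho> norm_p_pos by simp
    have "?A \<longleftrightarrow> (\<forall>t\<ge>\<rho> * norm_p. integrable M (\<lambda>\<omega>. X \<omega> powr q)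
        \<and> tail_moment t \<le> B powr q * t powr q * tail t)"
      using \<rho> t0 by (simp add: threshold_iff nn_tail_moment_le_iff tail_def)
        (meson less_imp_le order_trans)
    then show ?thesis by blast
  qed
  have "?L \<longleftrightarrow> (\<forall>\<rho>>0. \<exists>B\<ge>0. integrable M (\<lambda>\<omega>. X \<omega> powr q) \<and>
      (\<forall>t\<ge>\<rho> * norm_p. tail_moment t \<le> B powr q * t powr q * tail t))"
    using step by simp
  also have "\<dots> \<longleftrightarrow> tail_moment_bounded"
  proof
    assume *: "\<forall>\<rho>>0. \<exists>B\<ge>0. integrable M (\<lambda>\<omega>. X \<omega> powr q) \<and>
      (\<forall>t\<ge>\<rho> * norm_p. tail_moment t \<le> B powr q * t powr q * tail t)"
    then have "integrable M (\<lambda>\<omega>. X \<omega> powr q)" using zero_less_one by blast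
    with * show tail_moment_bounded
      unfolding tail_moment_bounded_def by (meson powr_ge_zero)
  next
    assume *: tail_moment_bounded
    show "\<forall>\<rho>>0. \<exists>B\<ge>0. integrable M (\<lambda>\<omega>. X \<omega> powr q) \<and>
      (\<forall>t\<ge>\<rho> * norm_p. tail_moment t \<le> B powr q * t powr q * tail t)"
    proof (intro allI impI)
      fix \<rho> :: real assume "0 < \<rho>"
      then obtain b where "0 \<le> b" "\<forall>t\<ge>\<rho> * norm_p. tail_moment t \<le> b * t powr q * tail t"
        using * unfolding tail_moment_bounded_def by blast
      then show "\<exists>B\<ge>0. integrable M (\<lambda>\<omega>. X \<omega> powr q) \<and>
          (\<forall>t\<ge>\<rho> * norm_p. tail_moment t \<le> B powr q * t powr q * tail t)"
        using * q_pos unfolding tail_moment_bounded_def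
        by (intro exI[of _ "b powr (1 / q)"]) (simp add: powr_powr)
    qed
  qed
  finally show ?thesis .
qed

lemma tail_decays_iff:
  "(\<forall>\<rho>>0. \<forall>\<epsilon>>0. \<exists>D>1. \<forall>t\<ge>0. ennreal \<rho> * Lr_norm M p X \<le> ennreal t \<longrightarrow>
      D powr q * measure M {\<omega>\<in>space M. X \<omega> > D * t} \<le> \<epsilon> * measure M {\<omega>\<in>space M. X \<omega> > t})
    \<longleftrightarrow> tail_decays"
proof -
  have "(\<forall>t\<ge>0. ennreal \<rho> * Lr_norm M p X \<le> ennreal t \<longrightarrow>
      D powr q * measure M {\<omega>\<in>space M. X \<omega> > D * t} \<le> \<epsilon> * measure M {\<omega>\<in>space M. X \<omega> > t})
    \<longleftrightarrow> (\<forall>t\<ge>\<rho> * norm_p. D powr q * tail (D * t) \<le> \<epsilon> * tail t)" if "0 < \<rho>" for \<rho> \<epsilon> D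
  proof -
    have t0: "0 < \<rho> * norm_p" using that norm_p_pos by simp
    show ?thesis
      using that t0 by (simp add: threshold_iff tail_def) (meson less_imp_le order_trans)
  qed
  then show ?thesis by (simp add: tail_decays_def)
qed

lemma max_contraction_iff:
  "(\<exists>\<sigma>>0. \<forall>t\<ge>0. Lr_norm M q (\<lambda>\<omega>. max t (\<sigma> * X \<omega>)) \<le> Lr_norm M p (\<lambda>\<omega>. max t (X \<omega>)))
    \<longleftrightarrow> max_contraction"
proof -
  have step: "Lr_norm M q (\<lambda>\<omega>. max t (\<sigma> * X \<omega>)) \<le> Lr_norm M p (\<lambda>\<omega>. max t (X \<omega>)) \<longleftrightarrow>
      integrable M (\<lambda>\<omega>. max t (\<sigma> * X \<omega>) powr q) \<and>
      expectation (\<lambda>\<omega>. max t (\<sigma> * X \<omega>) powr q)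
        \<le> expectation (\<lambda>\<omega>. max t (X \<omega>) powr p) powr (q / p)"
    if "0 < \<sigma>" "0 \<le> t" for \<sigma> t
  proof -
    have abs: "\<bar>max t x\<bar> = max t x" for x using that by simp
    have int: "integrable M (\<lambda>\<omega>. \<bar>max t (X \<omega>)\<bar> powr p)"
      unfolding abs using int_max_powr[OF int_p p_pos \<open>0 \<le> t\<close>, of 1] by simp
    show ?thesis
      using Lr_norm_le_iff[of "\<lambda>\<omega>. max t (\<sigma> * X \<omega>)" M M "\<lambda>\<omega>. max t (X \<omega>)" p q 1]
        int p_pos q_pos unfolding abs by simp
  qed
  have int: "(\<forall>t\<ge>0. integrable M (\<lambda>\<omega>. max t (\<sigma> * X \<omega>) powr q)) \<longleftrightarrow> integrable M (\<lambda>\<omega>. X \<omega> powr q)"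
    if \<sigma>: "0 < \<sigma>" for \<sigma>
  proof
    assume "\<forall>t\<ge>0. integrable M (\<lambda>\<omega>. max t (\<sigma> * X \<omega>) powr q)"
    then have "integrable M (\<lambda>\<omega>. max 0 (\<sigma> * X \<omega>) powr q)" by simp
    also have "?this \<longleftrightarrow> integrable M (\<lambda>\<omega>. \<sigma> powr q * X \<omega> powr q)"
      using \<sigma> X_nonneg by (intro Bochner_Integration.integrable_cong) (auto simp: powr_mult)
    finally show "integrable M (\<lambda>\<omega>. X \<omega> powr q)" using \<sigma> by simp
  qed (use \<sigma> q_pos in \<open>auto intro!: int_max_powr\<close>)
  show ?thesis
    unfolding max_contraction_def using step int by (smt (verit, del_insts))
qed

lemma maxima_comparable_iff:
  assumes iid: "\<And>n. n \<ge> 1 \<Longrightarrow> iid_copies M X (N n) (Y n) n"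
  shows "(\<exists>C>0. \<forall>n\<ge>1.
      Lr_norm (N n) q (max_upto (Y n) n) \<le> ennreal C * Lr_norm (N n) p (max_upto (Y n) n))
    \<longleftrightarrow> maxima_comparable N Y"
proof -
  have "Lr_norm (N n) q (max_upto (Y n) n) \<le> ennreal C * Lr_norm (N n) p (max_upto (Y n) n) \<longleftrightarrow>
    integrable (N n) (\<lambda>\<omega>. \<bar>max_upto (Y n) n \<omega>\<bar> powr q) \<and>
    (\<integral>\<omega>. \<bar>max_upto (Y n) n \<omega>\<bar> powr q \<partial>N n)
      \<le> C powr q * (\<integral>\<omega>. \<bar>max_upto (Y n) n \<omega>\<bar> powr p \<partial>N n) powr (q / p)"
    if n: "1 \<le> n" and C: "0 < C" for n C
  proof -
    interpret iid_max M X p q "N n" "Y n" n by (rule iid_maxI[OF iid[OF n] n])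
    show ?thesis
      using int_Z_p p_pos q_pos C iid_copies_max_upto_measurable[OF iid]
      by (intro Lr_norm_le_iff) (auto simp: Z_def)
  qed
  then show ?thesis unfolding maxima_comparable_def by (intro ex_cong1 conj_cong) auto
qed

end

theorem theorem4p6:
  fixes M :: "'a measure" and X :: "'a \<Rightarrow> real"
    and N :: "nat \<Rightarrow> 'b measure" and Y :: "nat \<Rightarrow> nat \<Rightarrow> 'b \<Rightarrow> real"
    and p q :: real
  assumes "prob_space M"
    and "X \<in> borel_measurable M"
    and "\<forall>\<omega>\<in>space M. 0 \<le> X \<omega>"
    and "0 < p" and "p < q"
    and "\<forall>n\<ge>1. iid_copies M X (N n) (Y n) n"
  defines "cond_i \<equiv> \<exists>C>0. \<forall>n\<ge>1.
      Lr_norm (N n) q (max_upto (Y n) n) \<le> ennreal C * Lr_norm (N n) p (max_upto (Y n) n)"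
    and "cond_ii \<equiv> \<forall>\<rho>>0. \<exists>B\<ge>0. \<forall>t\<ge>0. ennreal \<rho> * Lr_norm M p X \<le> ennreal t \<longrightarrow>
      (\<integral>\<^sup>+ \<omega>. ennreal (X \<omega> powr q * indicator {\<omega>. X \<omega> > t} \<omega>) \<partial>M)
        \<le> ennreal (B powr q * t powr q * measure M {\<omega>\<in>space M. X \<omega> > t})"
    and "cond_iii \<equiv> \<forall>\<rho>>0. \<forall>\<epsilon>>0. \<exists>D>1. \<forall>t\<ge>0. ennreal \<rho> * Lr_norm M p X \<le> ennreal t \<longrightarrow>
      D powr q * measure M {\<omega>\<in>space M. X \<omega> > D * t} \<le> \<epsilon> * measure M {\<omega>\<in>space M. X \<omega> > t}"
    and "cond_iv \<equiv> \<exists>\<sigma>>0. \<forall>t\<ge>0.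
      Lr_norm M q (\<lambda>\<omega>. max t (\<sigma> * X \<omega>)) \<le> Lr_norm M p (\<lambda>\<omega>. max t (X \<omega>))"
  shows "(cond_i \<longleftrightarrow> cond_ii) \<and> (cond_ii \<longleftrightarrow> cond_iii) \<and> (cond_iii \<longleftrightarrow> cond_iv)"
proof -
  interpret prob_space M by fact
  note [measurable] = assms(2)
  have nonneg: "0 \<le> X \<omega>" if "\<omega> \<in> space M" for \<omega> using assms(3) that by blast
  have iid: "iid_copies M X (N n) (Y n) n" if "n \<ge> 1" for n using assms(6) that by blast
  have q: "0 < q" using assms(4,5) by simp
  consider (infinite) "(\<integral>\<^sup>+ \<omega>. ennreal (\<bar>X \<omega>\<bar> powr p) \<partial>M) = \<infinity>"
    | (zero) "AE \<omega> in M. X \<omega> = 0"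
    | (proper) "nonneg_rv M X p q"
  proof (cases "(\<integral>\<^sup>+ \<omega>. ennreal (\<bar>X \<omega>\<bar> powr p) \<partial>M) = \<infinity>")
    case False
    then have "integrable M (\<lambda>\<omega>. \<bar>X \<omega>\<bar> powr p)"
      by (intro integrableI_nonneg) (auto simp: top.not_eq_extremum)
    also have "?this \<longleftrightarrow> integrable M (\<lambda>\<omega>. X \<omega> powr p)"
      using nonneg by (intro Bochner_Integration.integrable_cong) auto
    finally have int: "integrable M (\<lambda>\<omega>. X \<omega> powr p)" .
    show thesis
    proof (cases "expectation (\<lambda>\<omega>. X \<omega> powr p) = 0")
      case True
      then have "AE \<omega> in M. X \<omega> powr p = 0"
        using int by (subst (asm) integral_nonneg_eq_0_iff_AE) auto
      then show thesis by (intro zero) simp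
    next
      case False
      moreover have "0 \<le> expectation (\<lambda>\<omega>. X \<omega> powr p)"
        by (intro integral_nonneg_AE) auto
      ultimately have "0 < expectation (\<lambda>\<omega>. X \<omega> powr p)" by linarith
      then show thesis
        using int nonneg assms(4,5) by (intro proper) (unfold_locales, auto)
    qed
  qed (rule infinite)
  then show ?thesis
  proof cases
    case infinite
    have top: "Lr_norm M p X = \<infinity>" using infinite by (rule Lr_norm_infinite)
    have no_t: "\<not> ennreal \<rho> * Lr_norm M p X \<le> ennreal t" if "0 < \<rho>" for \<rho> t
      using that by (simp add: top ennreal_mult_top top_unique)
    have cond_i
    proof -
      have "Lr_norm (N n) p (max_upto (Y n) n) = \<infinity>" if n: "n \<ge> 1" for n
      proof (rule Lr_norm_infinite)
        have 1: "1 \<in> {1..n}" using n by simp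
        have "AE \<omega> in N n. \<forall>j\<in>{1..n}. 0 \<le> Y n j \<omega>"
          using nonneg by (intro iid_copies_AE[OF iid[OF n] assms(2)] AE_I2) auto
        then have "AE \<omega> in N n. \<bar>Y n 1 \<omega>\<bar> powr p \<le> \<bar>max_upto (Y n) n \<omega>\<bar> powr p"
        proof eventually_elim
          case (elim \<omega>)
          then show ?case
            using abs_max_upto(1)[of n "Y n" \<omega>] n 1 assms(4) by (intro powr_mono2) auto
        qed
        then have "(\<integral>\<^sup>+ \<omega>. ennreal (\<bar>Y n 1 \<omega>\<bar> powr p) \<partial>N n)
            \<le> (\<integral>\<^sup>+ \<omega>. ennreal (\<bar>max_upto (Y n) n \<omega>\<bar> powr p) \<partial>N n)"
          by (intro nn_integral_mono_AE) (auto simp: ennreal_leI)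
        moreover have "(\<integral>\<^sup>+ \<omega>. ennreal (\<bar>Y n 1 \<omega>\<bar> powr p) \<partial>N n) = \<infinity>"
          using iid_copies_nn_integral[OF iid[OF n] 1 assms(2), of "\<lambda>x. ennreal (\<bar>x\<bar> powr p)"] infinite
          by simp
        ultimately show "(\<integral>\<^sup>+ \<omega>. ennreal (\<bar>max_upto (Y n) n \<omega>\<bar> powr p) \<partial>N n) = \<infinity>"
          by (simp add: top_unique)
      qed
      then show ?thesis unfolding cond_i_def by (intro exI[of _ 1]) simp
    qed
    moreover have cond_ii unfolding cond_ii_def using no_t by (auto intro!: exI[of _ 0])
    moreover have cond_iii unfolding cond_iii_def using no_t by (auto intro!: exI[of _ 2])
    moreover have cond_iv
    proof -
      have "Lr_norm M p (\<lambda>\<omega>. max t (X \<omega>)) = \<infinity>" if "0 \<le> t" for t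
      proof (rule Lr_norm_infinite)
        have "(\<integral>\<^sup>+ \<omega>. ennreal (\<bar>X \<omega>\<bar> powr p) \<partial>M) \<le> (\<integral>\<^sup>+ \<omega>. ennreal (\<bar>max t (X \<omega>)\<bar> powr p) \<partial>M)"
          using that nonneg assms(4) by (intro nn_integral_mono ennreal_leI powr_mono2) auto
        then show "(\<integral>\<^sup>+ \<omega>. ennreal (\<bar>max t (X \<omega>)\<bar> powr p) \<partial>M) = \<infinity>"
          using infinite by (simp add: top_unique)
      qed
      then show ?thesis unfolding cond_iv_def by (intro exI[of _ 1]) simp
    qed
    ultimately show ?thesis by blast
  next
    case zero
    have null: "measure M {\<omega>\<in>space M. X \<omega> > t} = 0" if "0 \<le> t" for t
    proof -
      have "AE \<omega> in M. \<not> X \<omega> > t" using zero by eventually_elim (use that in simp)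
      then show ?thesis by (subst (asm) AE_iff_measurable[OF _ refl]) (auto simp: emeasure_eq_measure)
    qed
    have cond_i
    proof -
      have "Lr_norm (N n) q (max_upto (Y n) n) = 0" if n: "n \<ge> 1" for n
      proof -
        have "AE \<omega> in N n. \<forall>j\<in>{1..n}. Y n j \<omega> = 0"
          using zero by (intro iid_copies_AE[OF iid[OF n] assms(2)]) auto
        then have "AE \<omega> in N n. ennreal (\<bar>max_upto (Y n) n \<omega>\<bar> powr q) = 0"
        proof eventually_elim
          case (elim \<omega>)
          then show ?case using abs_max_upto(2)[of n "Y n" \<omega>] n by auto
        qed
        then have "(\<integral>\<^sup>+ \<omega>. ennreal (\<bar>max_upto (Y n) n \<omega>\<bar> powr q) \<partial>N n) = 0"
          by (subst nn_integral_cong_AE[where v = "\<lambda>_. 0"]) auto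
        then show ?thesis by (simp add: Lr_norm_def ennreal_powr_def)
      qed
      then show ?thesis unfolding cond_i_def by (intro exI[of _ 1]) simp
    qed
    moreover have cond_ii
    proof -
      have "AE \<omega> in M. ennreal (X \<omega> powr q * indicator {\<omega>. X \<omega> > t} \<omega>) = 0" for t
        using zero by eventually_elim simp
      then have "(\<integral>\<^sup>+ \<omega>. ennreal (X \<omega> powr q * indicator {\<omega>. X \<omega> > t} \<omega>) \<partial>M) = 0" for t
        by (subst nn_integral_cong_AE[where v = "\<lambda>_. 0"]) auto
      then show ?thesis unfolding cond_ii_def by (auto intro!: exI[of _ 0])
    qed
    moreover have cond_iii unfolding cond_iii_def using null by (auto intro!: exI[of _ 2])
    moreover have cond_iv
    proof -
      have const: "Lr_norm M r (\<lambda>\<omega>. max t (X \<omega>)) = ennreal t" if "0 \<le> t" "0 < r" for r t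
      proof -
        have "AE \<omega> in M. ennreal (\<bar>max t (X \<omega>)\<bar> powr r) = ennreal (t powr r)"
          using zero by eventually_elim (use that in simp)
        then have "(\<integral>\<^sup>+ \<omega>. ennreal (\<bar>max t (X \<omega>)\<bar> powr r) \<partial>M) = ennreal (t powr r)"
          by (subst nn_integral_cong_AE[where v = "\<lambda>_. ennreal (t powr r)"]) (auto simp: emeasure_space_1)
        then show ?thesis using that by (simp add: Lr_norm_def ennreal_powr_def powr_powr)
      qed
      then show ?thesis unfolding cond_iv_def using q assms(4) by (intro exI[of _ 1]) simp
    qed
    ultimately show ?thesis by blast
  next
    case proper
    interpret nonneg_rv M X p q by (rule proper)
    have "cond_i \<longleftrightarrow> maxima_comparable N Y"
      unfolding cond_i_def using iid by (rule maxima_comparable_iff)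
    moreover have "cond_ii \<longleftrightarrow> tail_moment_bounded"
      unfolding cond_ii_def by (rule tail_moment_bounded_iff)
    moreover have "cond_iii \<longleftrightarrow> tail_decays"
      unfolding cond_iii_def by (rule tail_decays_iff)
    moreover have "cond_iv \<longleftrightarrow> max_contraction"
      unfolding cond_iv_def by (rule max_contraction_iff)
    ultimately show ?thesis
      using tail_moment_bounded_imp_maxima_comparable[OF iid] maxima_comparable_imp_tail_moment_bounded[OF iid]
        tail_moment_bounded_imp_tail_decays tail_decays_imp_tail_moment_bounded
        tail_moment_bounded_imp_max_contraction max_contraction_imp_tail_moment_bounded
      by blast
  qed
qed

end
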